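(* Let $\mathcal C$ be a set of frame conditions. For every $n\in\mathbb N$, every variable $x$ and all formulas $\phi_0,\dots,\phi_{n+1}$ such that $x$ does not occur free in $\phi_0,\dots,\phi_n$: if the nested sequent consisting of the single formula $\phi_0\supset\Box(\phi_1\supset\cdots\supset\Box(\phi_n\supset\Box\phi_{n+1})\cdots)$ is provable in $\mathsf{N}\mathsf{Q}^{\circ}_{=}.\mathsf{K}(\mathcal{C})$, then so is the nested sequent consisting of the single formula $\phi_0\supset\Box(\phi_1\supset\cdots\supset\Box(\phi_n\supset\Box\forall x\,\phi_{n+1})\cdots)$.
   Context: Syntax. Terms are variables or constants. Formulas (negation normal form): $\phi ::= P(\vec t)\mid \neg P(\vec t)\mid t=s\mid t\neq s\mid \phi\lor\phi\mid\phi\land\phi\mid\exists x\phi\mid\forall x\phi\mid\Diamond\phi\mid\Box\phi$ ($P$ an $n$-ary predicate, $n\ge 0$). A literal is $P(\vec t)$, $\neg P(\vec t)$, $t=s$ or $t\neq s$; a negative literal is $\neg P(\vec t)$ or $t\neq s$. The negation $\overline{\phi}$ swaps $P(\vec t)/\neg P(\vec t)$, $=/\neq$, $\lor/\land$, $\exists/\forall$, $\Diamond/\Box$ (De Morgan duals); $\phi\supset\psi:=\overline\phi\lor\psi$. $\phi(t/x)$ is capture-avoiding substitution for free occurrences; formulas differing only in bound variable names are identified. Frames. A frame is $\langle W,R,U,D\rangle$ with $W\neq\emptyset$, $R\subseteq W\times W$, $U\neq\emptyset$ and $D_w\subseteq U$ for each $w\in W$. Frame conditions: $\mathbf D$: every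 $w$ has some $u$ with $wRu$; $\mathbf G(n,k)$ ($n,k\in\mathbb N$): $wR^nu$ and $wR^kv$ imply $uRv$ ($R^0$ = identity); $\mathbf{ID}$: $wRv\Rightarrow D_w\subseteq D_v$; $\mathbf{DD}$: $wRv\Rightarrow D_v\subseteq D_w$; $\mathbf{CD}$: $D_w=U$ for all $w$; $\mathbf{NE}$: $D_w\neq\emptyset$ for all $w$. $\mathcal C$ is a set of such conditions, assumed closed: if one of these conditions holds on every frame satisfying all of $\mathcal C$, it belongs to $\mathcal C$. $\mathbf G$ denotes the set of all $\mathbf G(n,k)\in\mathcal C$. Grammars. Characters $\mathsf f$, $\mathsf b$. A $\Sigma$-system $S$ is a set of productions $c\to s$, $c\in\{\mathsf f,\mathsf b\}$, $s$ a string over $\{\mathsf f,\mathsf b\}$; $s'cr'\to s'sr'$ is a one-step derivation, $\to^*_S$ its reflexive-transitive closure, $L_S(s)=\{t: s\to^*_S t\}$. $S(\mathbf G)$ contains $\mathsf f\to\mathsf b^n\mathsf f^k$ and $\mathsf b\to\mathsf b^k\mathsf f^n$ for each $\mathbf G(n,k)\in\mathbf G$; $S4=\{\mathsf f\to\varepsilon,\mathsf b\to\varepsilon,\mathsf f\to\mathsf f\mathsf f,\mathsf b\to\mathsf b\mathsf b\}$; $S5=\{\mathsf f\to\varepsilon,\mathsf b\to\varepsilon,\mathsf f\to\mathsf b\mathsf f,\mathsf b\to\mathsf b\mathsf f\}$. Nested sequents. A flat sequent is $\vec t,\vec\phi$: a finite multiset $\vec t$ of terms (signature) and a finite multiset $\vec\phi$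 of formulas. A nested sequent is $\Gamma,[\mathcal H_1],\dots,[\mathcal H_n]$ ($n\ge 0$) with $\Gamma$ flat and $\mathcal H_i$ nested sequents; it is a tree of flat sequents (components), each with a unique name, $\Gamma$ being the root and the roots of the $\mathcal H_i$ its children. A context $\mathcal G\{\}$ has a hole in a component; $\mathcal G\{\mathcal H\}$ fills it, $\mathcal G\{\emptyset\}$ removes it; $\mathcal G\{\cdot\}_{w}\{\cdot\}_{u}$ indicates holes in the components named $w,u$. Propagation: for each parent $w$ and child $u$ we have $w\xrightarrow{\mathsf f}u$ and $u\xrightarrow{\mathsf b}w$; $w\xrightarrow{c_1\cdots c_m}u$ means there are components $w=v_0,\dots,v_m=u$ with $v_{i-1}\xrightarrow{c_i}v_i$ ($w=u$ for the empty string); $w\xrightarrow{L}u$ means $w\xrightarrow{s}u$ for some $s\in L$. Calculus. Rules (premises $\Rightarrow$ conclusion): (ax) $\Rightarrow\mathcal G\{L,\overline L\}$, $L$ a literal; ($\lor$) $\mathcal G\{\phi,\psi\}\Rightarrow\mathcal G\{\phi\lor\psi\}$; ($\land$) $\mathcal G\{\phi\}$, $\mathcal G\{\psi\}\Rightarrow\mathcal G\{\phi\land\psi\}$; ($\exists$) $\mathcal G\{t,\exists x\psi,\psi(t/x)\}\Rightarrow\mathcal G\{t,\exists x\psi\}$; ($\forall$) $\mathcal G\{y,\phi(y/x)\}\Rightarrow\mathcal G\{\forall x\phi\}$, $y$ a variable not free in the conclusion; ($\Diamond$) $\mathcal G\{\Diamond\phi\}_w\{\phi\}_u\Rightarrow\mathcal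 G\{\Diamond\phi\}_w\{\emptyset\}_u$ provided $w\xrightarrow{L}u$, $L=L_{S(\mathbf G)}(\mathsf f)$; ($\Box$) $\mathcal G\{[\phi]\}\Rightarrow\mathcal G\{\Box\phi\}$; (ref) $\mathcal G\{t\neq t\}\Rightarrow\mathcal G\{\emptyset\}$; (rep) $\mathcal G\{t\neq s,N(t/z),N(s/z)\}\Rightarrow\mathcal G\{t\neq s,N(t/z)\}$, $N$ a negative literal; (drep) $\mathcal G\{s,t,t\neq s\}\Rightarrow\mathcal G\{t,t\neq s\}$; (rig) $\mathcal G\{s\neq t\}_w\{s\neq t\}_u\Rightarrow\mathcal G\{s\neq t\}_w\{\emptyset\}_u$, $w\neq u$; (dp) $\mathcal G\{t\}_w\{t\}_u\Rightarrow\mathcal G\{t\}_w\{\emptyset\}_u$, $w\neq u$, $w\xrightarrow{L}u$ with $L=L_{S4\cup S(\mathbf G)}(\mathsf f)$ if $\mathbf{ID}\in\mathcal C,\mathbf{DD}\notin\mathcal C$, $L=L_{S4\cup S(\mathbf G)}(\mathsf b)$ if $\mathbf{DD}\in\mathcal C,\mathbf{ID}\notin\mathcal C$, $L=L_{S5}(\mathsf f)$ if both; (d) $\mathcal G\{[\emptyset]\}\Rightarrow\mathcal G\{\emptyset\}$; (nd) $\mathcal G\{y\}\Rightarrow\mathcal G\{\emptyset\}$, $y$ a variable not free in the conclusion; (cd) $\mathcal G\{t\}\Rightarrow\mathcal G\{\emptyset\}$. $\mathsf N\mathsf Q^\circ_=.\mathsf K(\mathcal C)$ consists of ax, $\lor$,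 $\land$, $\exists$, $\forall$, $\Diamond$, $\Box$, ref, rep, drep, rig, plus dp iff $\mathcal C\cap\{\mathbf{ID},\mathbf{DD}\}\neq\emptyset$, nd iff $\mathbf{NE}\in\mathcal C$, cd iff $\mathbf{CD}\in\mathcal C$, d iff $\mathbf D\in\mathcal C$. A proof is a finite tree of nested sequents whose nodes are conclusions of rule instances with their children as premises and whose leaves are ax instances. *)

theory Defs
  imports "HOL-Library.Multiset" "HOL-Library.Countable_Set"
begin

section \<open>Formulas\<close>

text \<open>
  Formulas that differ only in the names of bound variables are identified. To this end formulas
  are de Bruijn trees over the variables 0, 1, 2, ...: below \<open>d\<close> quantifiers, \<open>Var i\<close> with
  \<open>i < d\<close> is the variable bound by the \<open>i\<close>-th enclosing quantifier (counted from inside), while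
  \<open>Var (y + d)\<close> is the free variable \<open>y\<close>. Every tree is well-formed, and trees correspond one to one
  to formulas up to renaming of bound variables. The calculus only mentions the named operations
  \<open>Forall x \<phi>\<close>, \<open>Exists x \<phi>\<close>, \<open>subst \<phi> t x\<close> and \<open>fv \<phi>\<close> defined below.
  The \<open>n\<close>-ary predicate symbols are the pairs of a \<open>P :: 'p\<close> and the arity \<open>n\<close>, which is
  the length of the argument list.
\<close>

type_synonym var = nat

datatype 'c tm = Var var | Const 'c

datatype ('p, 'c) fm =
    Atom 'p "'c tm list"
  | NAtom 'p "'c tm list"
  | Eq "'c tm" "'c tm"
  | Neq "'c tm" "'c tm"
  | Disj "('p, 'c) fm" "('p, 'c) fm"
  | Conj "('p, 'c) fm" "('p, 'c) fm"
  | ExB "('p, 'c) fm"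
  | AllB "('p, 'c) fm"
  | Dia "('p, 'c) fm"
  | Box "('p, 'c) fm"

fun is_literal :: "('p, 'c) fm \<Rightarrow> bool" where
  "is_literal (Atom P ts) = True"
| "is_literal (NAtom P ts) = True"
| "is_literal (Eq t s) = True"
| "is_literal (Neq t s) = True"
| "is_literal _ = False"

fun is_neg_literal :: "('p, 'c) fm \<Rightarrow> bool" where
  "is_neg_literal (NAtom P ts) = True"
| "is_neg_literal (Neq t s) = True"
| "is_neg_literal _ = False"

primrec neg :: "('p, 'c) fm \<Rightarrow> ('p, 'c) fm" where
  "neg (Atom P ts) = NAtom P ts"
| "neg (NAtom P ts) = Atom P ts"
| "neg (Eq t s) = Neq t s"
| "neg (Neq t s) = Eq t s"
| "neg (Disj \<phi> \<psi>) = Conj (neg \<phi>) (neg \<psi>)"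
| "neg (Conj \<phi> \<psi>) = Disj (neg \<phi>) (neg \<psi>)"
| "neg (ExB \<phi>) = AllB (neg \<phi>)"
| "neg (AllB \<phi>) = ExB (neg \<phi>)"
| "neg (Dia \<phi>) = Box (neg \<phi>)"
| "neg (Box \<phi>) = Dia (neg \<phi>)"

definition Imp :: "('p, 'c) fm \<Rightarrow> ('p, 'c) fm \<Rightarrow> ('p, 'c) fm" where
  "Imp \<phi> \<psi> = Disj (neg \<phi>) \<psi>"

fun fv_tm_at :: "nat \<Rightarrow> 'c tm \<Rightarrow> var set" where
  "fv_tm_at d (Var i) = (if i < d then {} else {i - d})"
| "fv_tm_at d (Const c) = {}"

abbreviation fv_tm :: "'c tm \<Rightarrow> var set" where
  "fv_tm \<equiv> fv_tm_at 0"

primrec fv_at :: "nat \<Rightarrow> ('p, 'c) fm \<Rightarrow> var set" where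
  "fv_at d (Atom P ts) = (\<Union>t\<in>set ts. fv_tm_at d t)"
| "fv_at d (NAtom P ts) = (\<Union>t\<in>set ts. fv_tm_at d t)"
| "fv_at d (Eq t s) = fv_tm_at d t \<union> fv_tm_at d s"
| "fv_at d (Neq t s) = fv_tm_at d t \<union> fv_tm_at d s"
| "fv_at d (Disj \<phi> \<psi>) = fv_at d \<phi> \<union> fv_at d \<psi>"
| "fv_at d (Conj \<phi> \<psi>) = fv_at d \<phi> \<union> fv_at d \<psi>"
| "fv_at d (ExB \<phi>) = fv_at (Suc d) \<phi>"
| "fv_at d (AllB \<phi>) = fv_at (Suc d) \<phi>"
| "fv_at d (Dia \<phi>) = fv_at d \<phi>"
| "fv_at d (Box \<phi>) = fv_at d \<phi>"

abbreviation fv :: "('p, 'c) fm \<Rightarrow> var set" where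
  "fv \<equiv> fv_at 0"

text \<open>\<open>map_at h 0 \<phi>\<close> applies \<open>h d\<close> to every term of \<open>\<phi>\<close> that lies below \<open>d\<close> quantifiers.\<close>

primrec map_at :: "(nat \<Rightarrow> 'c tm \<Rightarrow> 'c tm) \<Rightarrow> nat \<Rightarrow> ('p, 'c) fm \<Rightarrow> ('p, 'c) fm" where
  "map_at h d (Atom P ts) = Atom P (map (h d) ts)"
| "map_at h d (NAtom P ts) = NAtom P (map (h d) ts)"
| "map_at h d (Eq t s) = Eq (h d t) (h d s)"
| "map_at h d (Neq t s) = Neq (h d t) (h d s)"
| "map_at h d (Disj \<phi> \<psi>) = Disj (map_at h d \<phi>) (map_at h d \<psi>)"
| "map_at h d (Conj \<phi> \<psi>) = Conj (map_at h d \<phi>) (map_at h d \<psi>)"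
| "map_at h d (ExB \<phi>) = ExB (map_at h (Suc d) \<phi>)"
| "map_at h d (AllB \<phi>) = AllB (map_at h (Suc d) \<phi>)"
| "map_at h d (Dia \<phi>) = Dia (map_at h d \<phi>)"
| "map_at h d (Box \<phi>) = Box (map_at h d \<phi>)"

fun lift_tm :: "nat \<Rightarrow> 'c tm \<Rightarrow> 'c tm" where
  "lift_tm d (Var i) = Var (i + d)"
| "lift_tm d (Const c) = Const c"

fun subst_tm_at :: "'c tm \<Rightarrow> var \<Rightarrow> nat \<Rightarrow> 'c tm \<Rightarrow> 'c tm" where
  "subst_tm_at t x d (Var i) = (if i = x + d then lift_tm d t else Var i)"
| "subst_tm_at t x d (Const c) = Const c"

definition subst :: "('p, 'c) fm \<Rightarrow> 'c tm \<Rightarrow> var \<Rightarrow> ('p, 'c) fm" where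
  "subst \<phi> t x = map_at (subst_tm_at t x) 0 \<phi>"

text \<open>\<open>bind x \<phi>\<close> is the body of a quantifier over the free variable \<open>x\<close> of \<open>\<phi>\<close>: the free
  occurrences of \<open>x\<close> become references to the new quantifier, and the other free variables are
  shifted past it.\<close>

fun bind_tm_at :: "var \<Rightarrow> nat \<Rightarrow> 'c tm \<Rightarrow> 'c tm" where
  "bind_tm_at x d (Var i) =
     (if i < d then Var i else if i = x + d then Var d else Var (Suc i))"
| "bind_tm_at x d (Const c) = Const c"

definition bind :: "var \<Rightarrow> ('p, 'c) fm \<Rightarrow> ('p, 'c) fm" where
  "bind x \<phi> = map_at (bind_tm_at x) 0 \<phi>"

definition Exists :: "var \<Rightarrow> ('p, 'c) fm \<Rightarrow> ('p, 'c) fm" where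
  "Exists x \<phi> = ExB (bind x \<phi>)"

definition Forall :: "var \<Rightarrow> ('p, 'c) fm \<Rightarrow> ('p, 'c) fm" where
  "Forall x \<phi> = AllB (bind x \<phi>)"

text \<open>The named operations satisfy the laws of formulas up to renaming of bound variables.\<close>

lemma map_at_cong:
  "(\<And>e t. d \<le> e \<Longrightarrow> fv_tm_at e t \<subseteq> fv_at d \<phi> \<Longrightarrow> f e t = g e t) \<Longrightarrow> map_at f d \<phi> = map_at g d \<phi>"
proof (induction \<phi> arbitrary: d)
  case (ExB \<phi>)
  have "map_at f (Suc d) \<phi> = map_at g (Suc d) \<phi>"
    by (rule ExB.IH) (use ExB.prems in simp)
  then show ?case by simp
next
  case (AllB \<phi>)
  have "map_at f (Suc d) \<phi> = map_at g (Suc d) \<phi>"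
    by (rule AllB.IH) (use AllB.prems in simp)
  then show ?case by simp
next
  case (Disj \<phi>1 \<phi>2)
  have "map_at f d \<phi>1 = map_at g d \<phi>1" "map_at f d \<phi>2 = map_at g d \<phi>2"
    by (rule Disj.IH; use Disj.prems in \<open>simp add: le_supI1 le_supI2\<close>)+
  then show ?case by simp
next
  case (Conj \<phi>1 \<phi>2)
  have "map_at f d \<phi>1 = map_at g d \<phi>1" "map_at f d \<phi>2 = map_at g d \<phi>2"
    by (rule Conj.IH; use Conj.prems in \<open>simp add: le_supI1 le_supI2\<close>)+
  then show ?case by simp
qed (auto intro!: UN_upper)

lemma map_at_map_at: "map_at g d (map_at f d \<phi>) = map_at (\<lambda>e t. g e (f e t)) d \<phi>"
  by (induction \<phi> arbitrary: d) auto

lemma map_at_ident: "map_at (\<lambda>e t. t) d \<phi> = \<phi>"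
  by (induction \<phi> arbitrary: d) (auto simp: map_idI)

lemma map_at_Suc: "map_at f (Suc d) \<phi> = map_at (\<lambda>e. f (Suc e)) d \<phi>"
  by (induction \<phi> arbitrary: d) auto

lemma fv_at_bind: "fv_at (Suc d) (map_at (bind_tm_at x) d \<phi>) = fv_at d \<phi> - {x}"
proof (induction \<phi> arbitrary: d)
  have tm: "fv_tm_at (Suc d) (bind_tm_at x d t) = fv_tm_at d t - {x}" for d and t :: "'b tm"
    by (cases t) auto
  {
    case Atom then show ?case by (auto simp: tm)
  next
    case NAtom then show ?case by (auto simp: tm)
  next
    case Eq then show ?case by (auto simp: tm)
  next
    case Neq then show ?case by (auto simp: tm)
  }
qed auto

lemma fv_Forall: "fv (Forall x \<phi>) = fv \<phi> - {x}"
  and fv_Exists: "fv (Exists x \<phi>) = fv \<phi> - {x}"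
  by (simp_all add: Forall_def Exists_def bind_def fv_at_bind)

lemma bind_alpha:
  assumes "y \<notin> fv \<phi> - {x}"
  shows "bind y (subst \<phi> (Var y) x) = bind x \<phi>"
proof -
  have "bind_tm_at y e (subst_tm_at (Var y) x e t) = bind_tm_at x e t"
    if "fv_tm_at e t \<subseteq> fv \<phi>" for e t
    using that assms by (cases t) auto
  then show ?thesis
    unfolding bind_def subst_def map_at_map_at by (intro map_at_cong) auto
qed

lemma Forall_alpha: "y \<notin> fv (Forall x \<phi>) \<Longrightarrow> Forall y (subst \<phi> (Var y) x) = Forall x \<phi>"
  and Exists_alpha: "y \<notin> fv (Exists x \<phi>) \<Longrightarrow> Exists y (subst \<phi> (Var y) x) = Exists x \<phi>"
  unfolding fv_Forall fv_Exists by (simp_all add: Forall_def Exists_def bind_alpha)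

lemma subst_Forall_same: "subst (Forall x \<phi>) t x = Forall x \<phi>"
  and subst_Exists_same: "subst (Exists x \<phi>) t x = Exists x \<phi>"
proof -
  have "subst_tm_at t x (Suc e) (bind_tm_at x e u) = bind_tm_at x e u" for e u
    by (cases u) auto
  then have "map_at (subst_tm_at t x) (Suc 0) (bind x \<phi>) = bind x \<phi>"
    unfolding bind_def map_at_Suc map_at_map_at by simp
  then show "subst (Forall x \<phi>) t x = Forall x \<phi>" "subst (Exists x \<phi>) t x = Exists x \<phi>"
    by (simp_all add: Forall_def Exists_def subst_def)
qed

lemma subst_Forall: "x \<noteq> y \<Longrightarrow> y \<notin> fv_tm t \<Longrightarrow> subst (Forall y \<phi>) t x = Forall y (subst \<phi> t x)"
  and subst_Exists: "x \<noteq> y \<Longrightarrow> y \<notin> fv_tm t \<Longrightarrow> subst (Exists y \<phi>) t x = Exists y (subst \<phi> t x)"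
proof -
  have "map_at (subst_tm_at t x) (Suc 0) (bind y \<phi>) = bind y (subst \<phi> t x)"
    if "x \<noteq> y" "y \<notin> fv_tm t"
  proof -
    have "subst_tm_at t x (Suc e) (bind_tm_at y e u) = bind_tm_at y e (subst_tm_at t x e u)" for e u
      using that by (cases u; cases t) auto
    then show ?thesis
      unfolding bind_def subst_def map_at_Suc map_at_map_at by simp
  qed
  then show "x \<noteq> y \<Longrightarrow> y \<notin> fv_tm t \<Longrightarrow> subst (Forall y \<phi>) t x = Forall y (subst \<phi> t x)"
    "x \<noteq> y \<Longrightarrow> y \<notin> fv_tm t \<Longrightarrow> subst (Exists y \<phi>) t x = Exists y (subst \<phi> t x)"
    by (simp_all add: Forall_def Exists_def subst_def)
qed

fun unbind_tm_at :: "var \<Rightarrow> nat \<Rightarrow> 'c tm \<Rightarrow> 'c tm" where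
  "unbind_tm_at x d (Var i) =
     (if i < d then Var i else if i = d then Var (x + d) else Var (i - 1))"
| "unbind_tm_at x d (Const c) = Const c"

lemma bind_inject:
  fixes \<phi> \<psi> :: "('p, 'c) fm"
  shows "bind x \<phi> = bind x \<psi> \<longleftrightarrow> \<phi> = \<psi>"
proof -
  have "unbind_tm_at x e (bind_tm_at x e t) = t" for e and t :: "'c tm"
    by (cases t) auto
  then have "map_at (unbind_tm_at x) 0 (bind x \<chi>) = \<chi>" for \<chi> :: "('p, 'c) fm"
    unfolding bind_def map_at_map_at by (simp add: map_at_ident)
  then show ?thesis by metis
qed

lemma Forall_inject: "Forall x \<phi> = Forall x \<psi> \<longleftrightarrow> \<phi> = \<psi>"
  and Exists_inject: "Exists x \<phi> = Exists x \<psi> \<longleftrightarrow> \<phi> = \<psi>"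
  by (simp_all add: Forall_def Exists_def bind_inject)

lemma bind_surj:
  assumes "x \<notin> fv_at (Suc 0) \<beta>"
  shows "\<exists>\<phi>. \<beta> = bind x \<phi>"
proof
  have "map_at (\<lambda>e t. bind_tm_at x (e - 1) (unbind_tm_at x (e - 1) t)) (Suc 0) \<beta>
      = map_at (\<lambda>e t. t) (Suc 0) \<beta>"
  proof (rule map_at_cong)
    fix e t assume "Suc 0 \<le> e" "fv_tm_at e t \<subseteq> fv_at (Suc 0) \<beta>"
    moreover have "t \<noteq> Var (x + e)" if "x \<notin> fv_tm_at e t"
      using that by auto
    ultimately have "Suc 0 \<le> e" "t \<noteq> Var (x + e)"
      using assms by blast+
    then show "bind_tm_at x (e - 1) (unbind_tm_at x (e - 1) t) = t"
      by (cases t; cases e) auto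
  qed
  then show "\<beta> = bind x (map_at (unbind_tm_at x) 0 \<beta>)"
    unfolding bind_def map_at_map_at by (simp add: map_at_Suc map_at_ident)
qed

lemma Forall_surj: "x \<notin> fv (AllB \<beta>) \<Longrightarrow> \<exists>\<phi>. AllB \<beta> = Forall x \<phi>"
  and Exists_surj: "x \<notin> fv (ExB \<beta>) \<Longrightarrow> \<exists>\<phi>. ExB \<beta> = Exists x \<phi>"
  by (simp_all add: Forall_def Exists_def bind_surj)

lemma neg_Forall: "neg (Forall x \<phi>) = Exists x (neg \<phi>)"
  and neg_Exists: "neg (Exists x \<phi>) = Forall x (neg \<phi>)"
proof -
  have "neg (map_at f d \<psi>) = map_at f d (neg \<psi>)" for f d and \<psi> :: "('a, 'b) fm"
    by (induction \<psi> arbitrary: d) auto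
  then show "neg (Forall x \<phi>) = Exists x (neg \<phi>)" "neg (Exists x \<phi>) = Forall x (neg \<phi>)"
    by (simp_all add: Forall_def Exists_def bind_def)
qed


section \<open>Frames and frame conditions\<close>

record ('w, 'u) frame =
  worlds :: "'w set"
  acc :: "('w \<times> 'w) set"
  objs :: "'u set"
  dom_at :: "'w \<Rightarrow> 'u set"

definition is_frame :: "('w, 'u) frame \<Rightarrow> bool" where
  "is_frame F \<longleftrightarrow> worlds F \<noteq> {} \<and> acc F \<subseteq> worlds F \<times> worlds F \<and> objs F \<noteq> {}
     \<and> (\<forall>w\<in>worlds F. dom_at F w \<subseteq> objs F)"

datatype fcond = D | G nat nat | ID | DD | CD | NE

primrec holds :: "('w, 'u) frame \<Rightarrow> fcond \<Rightarrow> bool" where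
  "holds F D \<longleftrightarrow> (\<forall>w\<in>worlds F. \<exists>u. (w, u) \<in> acc F)"
| "holds F (G n k) \<longleftrightarrow>
     (\<forall>w\<in>worlds F. \<forall>u v. (w, u) \<in> acc F ^^ n \<longrightarrow> (w, v) \<in> acc F ^^ k \<longrightarrow> (u, v) \<in> acc F)"
| "holds F ID \<longleftrightarrow> (\<forall>w v. (w, v) \<in> acc F \<longrightarrow> dom_at F w \<subseteq> dom_at F v)"
| "holds F DD \<longleftrightarrow> (\<forall>w v. (w, v) \<in> acc F \<longrightarrow> dom_at F v \<subseteq> dom_at F w)"
| "holds F CD \<longleftrightarrow> (\<forall>w\<in>worlds F. dom_at F w = objs F)"
| "holds F NE \<longleftrightarrow> (\<forall>w\<in>worlds F. dom_at F w \<noteq> {})"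

text \<open>Frames over the natural numbers suffice to express that a condition holds on every frame
  satisfying \<open>C\<close>, see \<open>entails_any_frame\<close> below.\<close>

definition entails :: "fcond set \<Rightarrow> fcond \<Rightarrow> bool" where
  "entails C c \<longleftrightarrow> (\<forall>F :: (nat, nat) frame. is_frame F \<longrightarrow> (\<forall>c'\<in>C. holds F c') \<longrightarrow> holds F c)"

definition cond_closed :: "fcond set \<Rightarrow> bool" where
  "cond_closed C \<longleftrightarrow> (\<forall>c. entails C c \<longrightarrow> c \<in> C)"

lemma relpow_subset: "R \<subseteq> S \<Longrightarrow> R ^^ n \<subseteq> S ^^ n" for R S :: "('a \<times> 'a) set"
  by (induction n) (simp_all add: relcomp_mono)

lemma relpow_Suc_iff: "(a, b) \<in> R ^^ Suc n \<longleftrightarrow> (\<exists>c. (a, c) \<in> R ^^ n \<and> (c, b) \<in> R)"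
  by auto

lemma relpow_finite_support:
  "(a, b) \<in> R ^^ n \<Longrightarrow> \<exists>A. finite A \<and> a \<in> A \<and> (a, b) \<in> (R \<inter> A \<times> A) ^^ n"
proof (induction n arbitrary: b)
  case 0
  then show ?case by (intro exI[of _ "{a}"]) auto
next
  case (Suc n)
  then obtain c where c: "(a, c) \<in> R ^^ n" "(c, b) \<in> R" by auto
  with Suc.IH obtain A where A: "finite A" "a \<in> A" "(a, c) \<in> (R \<inter> A \<times> A) ^^ n" by blast
  let ?B = "insert c (insert b A)"
  have "(a, c) \<in> (R \<inter> ?B \<times> ?B) ^^ n"
    using A(3) relpow_subset[of "R \<inter> A \<times> A" "R \<inter> ?B \<times> ?B" n] by blast
  then have "(a, b) \<in> (R \<inter> ?B \<times> ?B) ^^ Suc n" using c(2) by auto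
  then show ?case using A by (intro exI[of _ ?B]) auto
qed

lemma countable_failure:
  fixes F :: "('w, 'u) frame"
  assumes F: "is_frame F" and fail: "\<not> holds F c"
  obtains A B where "finite A" "finite B" "A \<subseteq> worlds F" "B \<subseteq> objs F"
    "\<And>W V. A \<subseteq> W \<Longrightarrow> B \<subseteq> V \<Longrightarrow> W \<subseteq> worlds F \<Longrightarrow> V \<subseteq> objs F \<Longrightarrow>
      \<not> holds \<lparr>worlds = W, acc = acc F \<inter> W \<times> W, objs = V, dom_at = \<lambda>w. dom_at F w \<inter> V\<rparr> c"
proof (cases c)
  case D
  with fail obtain w where "w \<in> worlds F" "\<forall>u. (w, u) \<notin> acc F" by auto
  then show ?thesis using D by (intro that[of "{w}" "{}"]) auto
next
  case (G n k)
  with fail obtain w u v where w: "w \<in> worlds F" "(w, u) \<in> acc F ^^ n" "(w, v) \<in> acc F ^^ k"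
    "(u, v) \<notin> acc F" by auto
  from w(2,3) obtain A A' where A: "finite A" "w \<in> A" "(w, u) \<in> (acc F \<inter> A \<times> A) ^^ n"
    and A': "finite A'" "w \<in> A'" "(w, v) \<in> (acc F \<inter> A' \<times> A') ^^ k"
    using relpow_finite_support by metis
  let ?W = "worlds F"
  have sub: "acc F \<subseteq> ?W \<times> ?W" using F by (auto simp: is_frame_def)
  show ?thesis
  proof (rule that[of "(A \<union> A') \<inter> ?W" "{}"])
    fix W V assume W: "(A \<union> A') \<inter> ?W \<subseteq> W" "W \<subseteq> ?W"
    have "acc F \<inter> A \<times> A \<subseteq> acc F \<inter> W \<times> W" "acc F \<inter> A' \<times> A' \<subseteq> acc F \<inter> W \<times> W"
      using sub W by auto
    then have "(w, u) \<in> (acc F \<inter> W \<times> W) ^^ n" "(w, v) \<in> (acc F \<inter> W \<times> W) ^^ k"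
      using A(3) A'(3) relpow_subset[THEN subsetD] by metis+
    moreover have "w \<in> W" using W w(1) A(2) by auto
    ultimately show
      "\<not> holds \<lparr>worlds = W, acc = acc F \<inter> W \<times> W, objs = V, dom_at = \<lambda>w. dom_at F w \<inter> V\<rparr> c"
      using w(4) G by auto
  qed (use A A' in auto)
next
  case ID
  with fail obtain w v d where "(w, v) \<in> acc F" "d \<in> dom_at F w" "d \<notin> dom_at F v" by auto
  moreover from this F have "w \<in> worlds F" "v \<in> worlds F" "d \<in> objs F"
    by (auto simp: is_frame_def)
  ultimately show ?thesis using ID by (intro that[of "{w, v}" "{d}"]) (simp_all, blast)
next
  case DD
  with fail obtain w v d where "(w, v) \<in> acc F" "d \<in> dom_at F v" "d \<notin> dom_at F w" by auto
  moreover from this F have "w \<in> worlds F" "v \<in> worlds F" "d \<in> objs F"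
    by (auto simp: is_frame_def)
  ultimately show ?thesis using DD by (intro that[of "{w, v}" "{d}"]) (simp_all, blast)
next
  case CD
  with fail F obtain w d where "w \<in> worlds F" "d \<in> objs F" "d \<notin> dom_at F w"
    by (auto simp: is_frame_def)
  then show ?thesis using CD by (intro that[of "{w}" "{d}"]) auto
next
  case NE
  with fail obtain w where "w \<in> worlds F" "dom_at F w = {}" by auto
  then show ?thesis using NE by (intro that[of "{w}" "{}"]) auto
qed

definition map_frame :: "('w \<Rightarrow> 'w2) \<Rightarrow> ('u \<Rightarrow> 'u2) \<Rightarrow> ('w, 'u) frame \<Rightarrow> ('w2, 'u2) frame" where
  "map_frame f g F = \<lparr>worlds = f ` worlds F, acc = map_prod f f ` acc F, objs = g ` objs F,
     dom_at = \<lambda>w. g ` dom_at F (inv_into (worlds F) f w)\<rparr>"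

lemma
  fixes F :: "('w, 'u) frame"
  assumes F: "is_frame F" and f: "inj_on f (worlds F)" and g: "inj_on g (objs F)"
  shows is_frame_map_frame: "is_frame (map_frame f g F)"
    and holds_map_frame: "holds (map_frame f g F) c \<longleftrightarrow> holds F c"
proof -
  let ?R = "acc F" and ?W = "worlds F"
  define S where "S = map_prod f f ` acc F"
  have sub: "a \<in> ?W" "b \<in> ?W" if "(a, b) \<in> ?R" for a b
    using F that by (auto simp: is_frame_def)
  have dom: "dom_at F a \<subseteq> objs F" if "a \<in> ?W" for a
    using F that by (auto simp: is_frame_def)
  show "is_frame (map_frame f g F)"
    using F f by (auto simp: is_frame_def map_frame_def subset_iff)
  have S: "(f a, f b) \<in> S \<longleftrightarrow> (a, b) \<in> ?R" if "a \<in> ?W" "b \<in> ?W" for a b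
    using that f sub by (auto simp: S_def inj_on_eq_iff)
  have step: "(f c, y) \<in> S \<longleftrightarrow> (\<exists>b\<in>?W. y = f b \<and> (c, b) \<in> ?R)" if "c \<in> ?W" for c y
  proof
    assume "(f c, y) \<in> S"
    then obtain p q where "(p, q) \<in> ?R" "f c = f p" "y = f q"
      by (auto simp: S_def)
    then show "\<exists>b\<in>?W. y = f b \<and> (c, b) \<in> ?R"
      using f that sub by (metis inj_onD)
  qed (use S that in blast)
  have pow: "(f a, y) \<in> S ^^ n \<longleftrightarrow> (\<exists>b\<in>?W. y = f b \<and> (a, b) \<in> ?R ^^ n)" if "a \<in> ?W" for a y n
  proof (induction n arbitrary: y)
    case 0
    then show ?case using that by auto
  next
    case (Suc n)
    have "(f a, y) \<in> S ^^ Suc n \<longleftrightarrow> (\<exists>c\<in>?W. (a, c) \<in> ?R ^^ n \<and> (f c, y) \<in> S)"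
      unfolding relpow_Suc_iff Suc.IH by auto
    also have "\<dots> \<longleftrightarrow> (\<exists>c\<in>?W. (a, c) \<in> ?R ^^ n \<and> (\<exists>b\<in>?W. y = f b \<and> (c, b) \<in> ?R))"
      using step by blast
    also have "\<dots> \<longleftrightarrow> (\<exists>b\<in>?W. y = f b \<and> (a, b) \<in> ?R ^^ Suc n)"
      unfolding relpow_Suc_iff using sub by blast
    finally show ?case .
  qed
  have img: "g ` X \<subseteq> g ` Y \<longleftrightarrow> X \<subseteq> Y" if "X \<subseteq> objs F" "Y \<subseteq> objs F" for X Y
    using g that by (auto simp: inj_on_def) blast
  have all_S: "(\<forall>w v. (w, v) \<in> S \<longrightarrow> P w v) \<longleftrightarrow> (\<forall>w v. (w, v) \<in> ?R \<longrightarrow> P (f w) (f v))" for P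
    by (auto simp: S_def)
  have inv: "inv_into ?W f (f w) = w" if "w \<in> ?W" for w
    using f that by (rule inv_into_f_f)
  have powW: "b \<in> ?W" if "(a, b) \<in> ?R ^^ n" "a \<in> ?W" for a b n
    using that(1) by (cases n) (use that sub in auto)
  show "holds (map_frame f g F) c \<longleftrightarrow> holds F c"
  proof (cases c)
    case D
    have "holds (map_frame f g F) c \<longleftrightarrow> (\<forall>w\<in>?W. \<exists>u. (f w, u) \<in> S)"
      by (simp add: D map_frame_def S_def)
    also have "\<dots> \<longleftrightarrow> holds F c"
    proof -
      have "(\<exists>u. (f w, u) \<in> S) \<longleftrightarrow> (\<exists>u. (w, u) \<in> ?R)" if "w \<in> ?W" for w
        using step[OF that] sub(2) by metis
      then show ?thesis by (simp add: D)
    qed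
    finally show ?thesis .
  next
    case (G n k)
    have "holds (map_frame f g F) c \<longleftrightarrow> (\<forall>w\<in>?W. \<forall>u\<in>?W. \<forall>v\<in>?W.
      (w, u) \<in> ?R ^^ n \<longrightarrow> (w, v) \<in> ?R ^^ k \<longrightarrow> (f u, f v) \<in> S)"
      unfolding G holds.simps map_frame_def frame.simps ball_simps S_def[symmetric]
      by (intro ball_cong refl) (simp only: pow, blast)
    also have "\<dots> \<longleftrightarrow> holds F c" unfolding G holds.simps using S powW by blast
    finally show ?thesis .
  next
    case ID
    have "holds (map_frame f g F) c \<longleftrightarrow> (\<forall>w v. (w, v) \<in> ?R \<longrightarrow> g ` dom_at F w \<subseteq> g ` dom_at F v)"
      unfolding ID holds.simps map_frame_def frame.simps S_def[symmetric] all_S using inv sub by simp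
    also have "\<dots> \<longleftrightarrow> holds F c"
      unfolding ID holds.simps using img dom sub by metis
    finally show ?thesis .
  next
    case DD
    have "holds (map_frame f g F) c \<longleftrightarrow> (\<forall>w v. (w, v) \<in> ?R \<longrightarrow> g ` dom_at F v \<subseteq> g ` dom_at F w)"
      unfolding DD holds.simps map_frame_def frame.simps S_def[symmetric] all_S using inv sub by simp
    also have "\<dots> \<longleftrightarrow> holds F c"
      unfolding DD holds.simps using img dom sub by metis
    finally show ?thesis .
  next
    case CD
    then show ?thesis using f inj_on_image_eq_iff[OF g] dom by (simp add: map_frame_def)
  next
    case NE
    then show ?thesis using f by (simp add: map_frame_def)
  qed
qed

lemma entails_any_frame:
  fixes F :: "('w, 'u) frame"
  assumes C: "entails C c" and F: "is_frame F" and sat: "\<And>c'. c' \<in> C \<Longrightarrow> holds F c'"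
  shows "holds F c"
proof (rule ccontr)
  assume "\<not> holds F c"
  then obtain A B where AB: "finite A" "finite B" "A \<subseteq> worlds F" "B \<subseteq> objs F"
    and fail: "\<And>W V. A \<subseteq> W \<Longrightarrow> B \<subseteq> V \<Longrightarrow> W \<subseteq> worlds F \<Longrightarrow> V \<subseteq> objs F \<Longrightarrow>
      \<not> holds \<lparr>worlds = W, acc = acc F \<inter> W \<times> W, objs = V, dom_at = \<lambda>w. dom_at F w \<inter> V\<rparr> c"
    using countable_failure[OF F] by metis
  obtain w0 d0 where w0: "w0 \<in> worlds F" and d0: "d0 \<in> objs F"
    using F by (auto simp: is_frame_def)
  define nxt where "nxt w = (if \<exists>u. (w, u) \<in> acc F then SOME u. (w, u) \<in> acc F else w)" for w
  define pick where "pick w = (if dom_at F w \<noteq> {} then SOME d. d \<in> dom_at F w else d0)" for w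
  have nxt: "(w, nxt w) \<in> acc F" if "(w, u) \<in> acc F" for w u
    unfolding nxt_def using that by (auto intro: someI)
  have pick: "pick w \<in> dom_at F w" if "dom_at F w \<noteq> {}" for w
    unfolding pick_def using that by (auto intro: someI)
  have nxtW: "nxt w \<in> worlds F" if "w \<in> worlds F" for w
  proof (cases "\<exists>u. (w, u) \<in> acc F")
    case True
    then show ?thesis using nxt F by (auto simp: is_frame_def)
  qed (use that in \<open>auto simp: nxt_def\<close>)
  have pickU: "pick w \<in> objs F" if "w \<in> worlds F" for w
  proof (cases "dom_at F w = {}")
    case False
    then show ?thesis using pick that F unfolding is_frame_def by blast
  qed (use d0 in \<open>auto simp: pick_def\<close>)
  define W where "W = (\<Union>n. (nxt ^^ n) ` insert w0 A)"
  define V where "V = insert d0 (B \<union> pick ` W)"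
  have "(nxt ^^ n) w \<in> worlds F" if "w \<in> worlds F" for n w
    using that by (induction n) (auto intro: nxtW)
  then have W: "W \<subseteq> worlds F" using AB w0 unfolding W_def by blast
  have V: "V \<subseteq> objs F" using AB d0 W pickU unfolding V_def by blast
  have AW: "insert w0 A \<subseteq> W" unfolding W_def by (intro subsetI UN_I[of 0]) auto
  have nW: "nxt w \<in> W" if w: "w \<in> W" for w
  proof -
    obtain n a where "a \<in> insert w0 A" "w = (nxt ^^ n) a" using w unfolding W_def by blast
    then have "nxt w = (nxt ^^ Suc n) a" "a \<in> insert w0 A" by auto
    then show ?thesis unfolding W_def by blast
  qed
  have pV: "pick w \<in> V" if "w \<in> W" for w using that by (auto simp: V_def)
  have cW: "countable W" unfolding W_def using AB by (auto intro: countable_finite)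
  then have cV: "countable V" unfolding V_def using AB by (auto intro: countable_finite)
  define F' where "F' = \<lparr>worlds = W, acc = acc F \<inter> W \<times> W, objs = V, dom_at = \<lambda>w. dom_at F w \<inter> V\<rparr>"
  have F': "is_frame F'" using AW by (auto simp: F'_def is_frame_def V_def)
  have powsub: "(acc F \<inter> W \<times> W) ^^ n \<subseteq> acc F ^^ n" for n
    by (rule relpow_subset) blast
  have "holds F' c'" if "c' \<in> C" for c'
  proof (cases c')
    case D
    have "(w, nxt w) \<in> acc F" if "w \<in> W" for w
      using sat[OF \<open>c' \<in> C\<close>] D nxt that W by auto
    then show ?thesis using D nW by (auto simp: F'_def)
  next
    case (G n k)
    have "(u, v) \<in> acc F \<inter> W \<times> W"
      if "w \<in> W" "(w, u) \<in> (acc F \<inter> W \<times> W) ^^ n" "(w, v) \<in> (acc F \<inter> W \<times> W) ^^ k" for w u v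
    proof -
      have "u \<in> W" using that(1,2) by (cases n) auto
      moreover have "v \<in> W" using that(1,3) by (cases k) auto
      moreover have "(u, v) \<in> acc F"
      proof -
        have "w \<in> worlds F" "(w, u) \<in> acc F ^^ n" "(w, v) \<in> acc F ^^ k"
          using that W powsub by blast+
        then show ?thesis using sat[OF \<open>c' \<in> C\<close>] unfolding G holds.simps by simp
      qed
      ultimately show ?thesis by blast
    qed
    then show ?thesis unfolding G F'_def holds.simps frame.simps by blast
  next
    case ID
    then show ?thesis using sat[OF that] by (simp add: F'_def) blast
  next
    case DD
    then show ?thesis using sat[OF that] by (simp add: F'_def) blast
  next
    case CD
    then show ?thesis using sat[OF that] W V by (auto simp: F'_def)
  next
    case NE
    have "pick w \<in> dom_at F w \<inter> V" if "w \<in> W" for w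
      using sat[OF \<open>c' \<in> C\<close>] NE pick pV that W by auto
    then show ?thesis using NE by (auto simp: F'_def)
  qed
  note F'_sat = this
  have inj: "inj_on (to_nat_on W) (worlds F')" "inj_on (to_nat_on V) (objs F')"
    using cW cV by (simp_all add: F'_def inj_on_to_nat_on)
  note is_frame_map_frame[OF F' inj] holds_map_frame[OF F' inj]
  then have "holds F' c"
    using C F'_sat unfolding entails_def by blast
  then show False
    using fail[of W V] AW W V by (auto simp: F'_def V_def)
qed


section \<open>Grammars\<close>

datatype dir = Fwd | Bwd

type_synonym sigma_system = "(dir \<times> dir list) set"

inductive derive1 :: "sigma_system \<Rightarrow> dir list \<Rightarrow> dir list \<Rightarrow> bool" for S where
  "(c, s) \<in> S \<Longrightarrow> derive1 S (p @ [c] @ r) (p @ s @ r)"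

definition lang :: "sigma_system \<Rightarrow> dir list \<Rightarrow> dir list set" where
  "lang S s = {t. (derive1 S)\<^sup>*\<^sup>* s t}"

definition sys_G :: "fcond set \<Rightarrow> sigma_system" where
  "sys_G C = {(Fwd, replicate n Bwd @ replicate k Fwd) | n k. G n k \<in> C}
           \<union> {(Bwd, replicate k Bwd @ replicate n Fwd) | n k. G n k \<in> C}"

definition sys_S4 :: sigma_system where
  "sys_S4 = {(Fwd, []), (Bwd, []), (Fwd, [Fwd, Fwd]), (Bwd, [Bwd, Bwd])}"

definition sys_S5 :: sigma_system where
  "sys_S5 = {(Fwd, []), (Bwd, []), (Fwd, [Bwd, Fwd]), (Bwd, [Bwd, Fwd])}"

definition dia_lang :: "fcond set \<Rightarrow> dir list set" where
  "dia_lang C = lang (sys_G C) [Fwd]"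

definition dp_lang :: "fcond set \<Rightarrow> dir list set" where
  "dp_lang C =
    (if ID \<in> C \<and> DD \<notin> C then lang (sys_S4 \<union> sys_G C) [Fwd]
     else if DD \<in> C \<and> ID \<notin> C then lang (sys_S4 \<union> sys_G C) [Bwd]
     else lang sys_S5 [Fwd])"


section \<open>Nested sequents\<close>

text \<open>\<open>Comp w X \<Gamma> Hs\<close> is the nested sequent whose root is the component named \<open>w\<close> with
  signature \<open>X\<close> and formulas \<open>\<Gamma>\<close>, and whose bracketed subsequents are \<open>Hs\<close>.\<close>

type_synonym name = nat

datatype ('p, 'c) nseq =
  Comp (root: name) "'c tm multiset" "('p, 'c) fm multiset" "('p, 'c) nseq multiset"

primrec names :: "('p, 'c) nseq \<Rightarrow> name multiset" where
  "names (Comp w X \<Gamma> Hs) = add_mset w (\<Sum>\<^sub># (image_mset names Hs))"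

definition uniquely_named :: "('p, 'c) nseq \<Rightarrow> bool" where
  "uniquely_named H \<longleftrightarrow> (\<forall>w. count (names H) w \<le> 1)"

primrec fv_nseq :: "('p, 'c) nseq \<Rightarrow> var set" where
  "fv_nseq (Comp w X \<Gamma> Hs) =
     (\<Union>t\<in>set_mset X. fv_tm t) \<union> (\<Union>\<phi>\<in>set_mset \<Gamma>. fv \<phi>) \<union> \<Union> (set_mset (image_mset fv_nseq Hs))"

primrec edges :: "('p, 'c) nseq \<Rightarrow> (name \<times> name) set" where
  "edges (Comp w X \<Gamma> Hs) =
     (\<lambda>H. (w, root H)) ` set_mset Hs \<union> \<Union> (set_mset (image_mset edges Hs))"

fun step :: "('p, 'c) nseq \<Rightarrow> dir \<Rightarrow> name \<Rightarrow> name \<Rightarrow> bool" where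
  "step H Fwd w u \<longleftrightarrow> (w, u) \<in> edges H"
| "step H Bwd w u \<longleftrightarrow> (u, w) \<in> edges H"

fun path :: "('p, 'c) nseq \<Rightarrow> dir list \<Rightarrow> name \<Rightarrow> name \<Rightarrow> bool" where
  "path H [] w u \<longleftrightarrow> w = u"
| "path H (c # s) w u \<longleftrightarrow> (\<exists>v. step H c w v \<and> path H s v u)"

definition reach :: "('p, 'c) nseq \<Rightarrow> dir list set \<Rightarrow> name \<Rightarrow> name \<Rightarrow> bool" where
  "reach H L w u \<longleftrightarrow> (\<exists>s\<in>L. path H s w u)"

text \<open>A context with a hole in its component \<open>w\<close> is represented by the nested sequent \<open>H\<close> that
  results from removing the hole, together with the name \<open>w\<close> of a component of \<open>H\<close>. Then
  \<open>fill w X \<Gamma> Hs H\<close> is the context filled with the terms \<open>X\<close>, the formulas \<open>\<Gamma>\<close> and the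
  bracketed nested sequents \<open>Hs\<close>. A context with two holes is filled by iterating \<open>fill\<close>.\<close>

primrec fill :: "name \<Rightarrow> 'c tm multiset \<Rightarrow> ('p, 'c) fm multiset \<Rightarrow> ('p, 'c) nseq multiset
    \<Rightarrow> ('p, 'c) nseq \<Rightarrow> ('p, 'c) nseq" where
  "fill w X \<Gamma> Hs (Comp v Y \<Delta> Ks) =
     (if v = w then Comp v (Y + X) (\<Delta> + \<Gamma>) (Ks + Hs)
      else Comp v Y \<Delta> (image_mset (fill w X \<Gamma> Hs) Ks))"


section \<open>The calculus\<close>

text \<open>Uniqueness of names is imposed in \<open>ax\<close> and is inherited by the conclusions of all other
  rules.\<close>

inductive provable :: "fcond set \<Rightarrow> ('p, 'c) nseq \<Rightarrow> bool" for C :: "fcond set" where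
  ax: "uniquely_named H \<Longrightarrow> w \<in># names H \<Longrightarrow> is_literal L \<Longrightarrow>
    provable C (fill w {#} {#L, neg L#} {#} H)"
| disj: "w \<in># names H \<Longrightarrow>
    provable C (fill w {#} {#\<phi>, \<psi>#} {#} H) \<Longrightarrow>
    provable C (fill w {#} {#Disj \<phi> \<psi>#} {#} H)"
| conj: "w \<in># names H \<Longrightarrow>
    provable C (fill w {#} {#\<phi>#} {#} H) \<Longrightarrow>
    provable C (fill w {#} {#\<psi>#} {#} H) \<Longrightarrow>
    provable C (fill w {#} {#Conj \<phi> \<psi>#} {#} H)"
| ex: "w \<in># names H \<Longrightarrow>
    provable C (fill w {#t#} {#Exists x \<psi>, subst \<psi> t x#} {#} H) \<Longrightarrow>
    provable C (fill w {#t#} {#Exists x \<psi>#} {#} H)"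
| all: "w \<in># names H \<Longrightarrow> y \<notin> fv_nseq (fill w {#} {#Forall x \<phi>#} {#} H) \<Longrightarrow>
    provable C (fill w {#Var y#} {#subst \<phi> (Var y) x#} {#} H) \<Longrightarrow>
    provable C (fill w {#} {#Forall x \<phi>#} {#} H)"
| dia: "w \<in># names H \<Longrightarrow> u \<in># names H \<Longrightarrow> reach H (dia_lang C) w u \<Longrightarrow>
    provable C (fill u {#} {#\<phi>#} {#} (fill w {#} {#Dia \<phi>#} {#} H)) \<Longrightarrow>
    provable C (fill w {#} {#Dia \<phi>#} {#} H)"
| box: "w \<in># names H \<Longrightarrow> v \<notin># names H \<Longrightarrow>
    provable C (fill w {#} {#} {#Comp v {#} {#\<phi>#} {#}#} H) \<Longrightarrow>
    provable C (fill w {#} {#Box \<phi>#} {#} H)"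
| ref: "w \<in># names H \<Longrightarrow>
    provable C (fill w {#} {#Neq t t#} {#} H) \<Longrightarrow>
    provable C H"
| rep: "w \<in># names H \<Longrightarrow> is_neg_literal N \<Longrightarrow>
    provable C (fill w {#} {#Neq t s, subst N t z, subst N s z#} {#} H) \<Longrightarrow>
    provable C (fill w {#} {#Neq t s, subst N t z#} {#} H)"
| drep: "w \<in># names H \<Longrightarrow>
    provable C (fill w {#s, t#} {#Neq t s#} {#} H) \<Longrightarrow>
    provable C (fill w {#t#} {#Neq t s#} {#} H)"
| rig: "w \<in># names H \<Longrightarrow> u \<in># names H \<Longrightarrow> w \<noteq> u \<Longrightarrow>
    provable C (fill u {#} {#Neq s t#} {#} (fill w {#} {#Neq s t#} {#} H)) \<Longrightarrow>
    provable C (fill w {#} {#Neq s t#} {#} H)"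
| dp: "ID \<in> C \<or> DD \<in> C \<Longrightarrow>
    w \<in># names H \<Longrightarrow> u \<in># names H \<Longrightarrow> w \<noteq> u \<Longrightarrow> reach H (dp_lang C) w u \<Longrightarrow>
    provable C (fill u {#t#} {#} {#} (fill w {#t#} {#} {#} H)) \<Longrightarrow>
    provable C (fill w {#t#} {#} {#} H)"
| d: "D \<in> C \<Longrightarrow> w \<in># names H \<Longrightarrow> v \<notin># names H \<Longrightarrow>
    provable C (fill w {#} {#} {#Comp v {#} {#} {#}#} H) \<Longrightarrow>
    provable C H"
| nd: "NE \<in> C \<Longrightarrow> w \<in># names H \<Longrightarrow> y \<notin> fv_nseq H \<Longrightarrow>
    provable C (fill w {#Var y#} {#} {#} H) \<Longrightarrow>
    provable C H"
| cd: "CD \<in> C \<Longrightarrow> w \<in># names H \<Longrightarrow>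
    provable C (fill w {#t#} {#} {#} H) \<Longrightarrow>
    provable C H"

lemma names_fill_flat: "names (fill w X \<Gamma> {#} H) = names H"
  by (induction H) (auto simp: multiset.map_comp intro!: arg_cong[of _ _ sum_mset] image_mset_cong)

lemma names_fill_mono: "names H \<subseteq># names (fill w X \<Gamma> Hs H)"
proof (induction H)
  case (Comp v Y \<Delta> Ks)
  have "\<Sum>\<^sub># (image_mset names Ks) \<subseteq># \<Sum>\<^sub># (image_mset (names \<circ> fill w X \<Gamma> Hs) Ks)"
    using Comp.IH by (induction Ks) (auto intro: subset_mset.add_mono)
  then show ?case by (auto simp: multiset.map_comp)
qed

lemma uniquely_named_fill: "uniquely_named (fill w X \<Gamma> Hs H) \<Longrightarrow> uniquely_named H"
  using mset_subset_eq_count[OF names_fill_mono] unfolding uniquely_named_def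
  by (meson order_trans)

lemma uniquely_named_fill_flat: "uniquely_named (fill w X \<Gamma> {#} H) \<longleftrightarrow> uniquely_named H"
  by (simp add: uniquely_named_def names_fill_flat)

lemma provable_uniquely_named: "provable C H \<Longrightarrow> uniquely_named H"
  by (induction rule: provable.induct)
    (auto simp: uniquely_named_fill_flat dest: uniquely_named_fill)

end

theory Submission
  imports Defs
begin

text \<open>
  The rules for disjunction and box are invertible, so a proof of the given formula yields a proof
  of the chain of components containing the negations of \<open>\<phi>\<^sub>0\<close>, ..., \<open>\<phi>\<^sub>n\<close> that ends in a
  component consisting of \<open>\<phi>\<^sub>n\<^sub>+\<^sub>1\<close>. After weakening that last component by the term \<open>x\<close>, the
  rule for the universal quantifier applies with \<open>x\<close> itself as eigenvariable, since \<open>x\<close> is free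
  nowhere else. Applying the rules for box and disjunction again rebuilds the formula.
\<close>

section \<open>Filling contexts\<close>

lemma root_fill [simp]: "root (fill w X \<Gamma> Hs H) = root H"
  by (cases H) simp

lemma fill_absent: "w \<notin># names H \<Longrightarrow> fill w X \<Gamma> Hs H = H"
proof (induction H)
  case (Comp v Y \<Delta> Ks)
  have "image_mset (fill w X \<Gamma> Hs) Ks = image_mset id Ks"
    using Comp by (intro image_mset_cong) auto
  then show ?case using Comp.prems by simp
qed

lemma fill_empty [simp]: "fill w {#} {#} {#} H = H"
proof (induction H)
  case (Comp v Y \<Delta> Ks)
  have "image_mset (fill w {#} {#} {#}) Ks = image_mset id Ks"
    using Comp by (intro image_mset_cong) auto
  then show ?case by simp
qed

lemma fill_fill:
  "fill w X \<Gamma> Hs (fill w Y \<Delta> {#} H) = fill w (Y + X) (\<Delta> + \<Gamma>) Hs H"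
  by (induction H) (auto simp: multiset.map_comp ac_simps intro!: image_mset_cong)

text \<open>The hypotheses keep each filling from reaching into the children brought in by the other
  one, so the order of the two is immaterial.\<close>

lemma fill_commute:
  assumes "\<And>H. H \<in># Hs \<Longrightarrow> a \<notin># names H" "\<And>H. H \<in># Ks \<Longrightarrow> w \<notin># names H"
  shows "fill a Y \<Delta> Ks (fill w X \<Gamma> Hs H) = fill w X \<Gamma> Hs (fill a Y \<Delta> Ks H)"
proof (induction H)
  case (Comp v Z \<Theta> Js)
  have "image_mset (fill a Y \<Delta> Ks) Hs = image_mset id Hs"
    using assms by (intro image_mset_cong) (auto simp: fill_absent)
  moreover have "image_mset (fill w X \<Gamma> Hs) Ks = image_mset id Ks"
    using assms by (intro image_mset_cong) (auto simp: fill_absent)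
  ultimately show ?case
    using Comp by (auto simp: multiset.map_comp ac_simps intro!: image_mset_cong)
qed

lemmas fill_commute_flat = fill_commute[where Hs = "{#}" and Ks = "{#}", simplified]

text \<open>Turns the formulas of a freshly added child into the filling of a hole in that child. An
  argument about arbitrary contexts can thereby descend from \<open>w\<close> into \<open>v\<close>
  and come back.\<close>

lemma fill_new_child:
  "v \<notin># names H \<Longrightarrow>
   fill v {#} \<Gamma> {#} (fill w X \<Delta> {#Comp v {#} {#} {#}#} H) = fill w X \<Delta> {#Comp v {#} \<Gamma> {#}#} H"
proof (induction H)
  case (Comp u Y \<Theta> Ks)
  have "image_mset (fill v {#} \<Gamma> {#}) Ks = image_mset id Ks"
    using Comp by (intro image_mset_cong) (auto simp: fill_absent)
  then show ?case
    using Comp by (auto simp: multiset.map_comp intro!: image_mset_cong)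
qed

section \<open>Names occurring in a filled context\<close>

lemma names_fill:
  "set_mset (names (fill w X \<Gamma> Hs H)) \<subseteq> set_mset (names H) \<union> \<Union> (set_mset ` names ` set_mset Hs)"
  by (induction H) auto

lemma names_fill_iff [simp]:
  "v \<in># names (fill w X \<Gamma> {#} H) \<longleftrightarrow> v \<in># names H"
  by (simp add: names_fill_flat)

lemma names_fillI: "v \<in># names H \<Longrightarrow> v \<in># names (fill w X \<Gamma> Hs H)"
  using names_fill_mono mset_subset_eqD by metis

lemma names_fill_child: "w \<in># names H \<Longrightarrow> v \<in># names (fill w X \<Gamma> {#Comp v Y \<Delta> Ks#} H)"
  by (induction H) auto

text \<open>\<open>fill\<close> may act in several branches of the tree; the bound on the
  occurrences of \<open>w\<close> ensures that at most one copy of \<open>Hs\<close> is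
  added.\<close>

lemma names_fill_once:
  "count (names H) w \<le> 1 \<Longrightarrow> names (fill w X \<Gamma> Hs H) \<subseteq># names H + \<Sum>\<^sub># (image_mset names Hs)"
proof (induction H)
  case (Comp u Y \<Delta> Ks)
  show ?case
  proof (cases "w \<in># names (Comp u Y \<Delta> Ks) \<and> u \<noteq> w")
    case True
    then obtain K Ks' where Ks: "Ks = add_mset K Ks'" and K: "w \<in># names K"
      by (auto dest: multi_member_split)
    then have "count (names K) w \<ge> 1"
      by (simp add: Suc_le_eq)
    \<comment> \<open>The bound is used up by \<open>K\<close>, so \<open>w\<close> is absent from
      the remaining children and filling leaves them unchanged.\<close>
    moreover have "count (names K) w + count (\<Sum>\<^sub># (image_mset names Ks')) w \<le> 1"
      using Comp.prems True by (simp add: Ks)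
    ultimately have "count (names K) w \<le> 1" and "count (\<Sum>\<^sub># (image_mset names Ks')) w = 0"
      by linarith+
    then have "count (names K) w \<le> 1" and "w \<notin># \<Sum>\<^sub># (image_mset names Ks')"
      by (simp_all only: not_in_iff)
    moreover from this(2) have "image_mset (fill w X \<Gamma> Hs) Ks' = image_mset id Ks'"
      by (intro image_mset_cong) (auto simp: fill_absent)
    ultimately show ?thesis
      using Comp.IH[of K] True by (simp add: Ks ac_simps subset_mset.add_left_mono)
  next
    case False
    then show ?thesis by (cases "u = w") (simp_all add: fill_absent del: fill.simps, simp)
  qed
qed

lemma uniquely_named_fill_child:
  assumes "uniquely_named H" "v \<notin># names H"
  shows "uniquely_named (fill w X \<Gamma> {#Comp v Y \<Delta> {#}#} H)"
  unfolding uniquely_named_def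
proof
  fix u
  have "names (fill w X \<Gamma> {#Comp v Y \<Delta> {#}#} H) \<subseteq># names H + {#v#}"
    using names_fill_once[of H w X \<Gamma> "{#Comp v Y \<Delta> {#}#}"] assms(1)
    by (simp add: uniquely_named_def)
  then have "count (names (fill w X \<Gamma> {#Comp v Y \<Delta> {#}#} H)) u \<le> count (names H + {#v#}) u"
    by (rule mset_subset_eq_count)
  also have "\<dots> \<le> 1"
    using assms by (auto simp: uniquely_named_def not_in_iff)
  finally show "count (names (fill w X \<Gamma> {#Comp v Y \<Delta> {#}#} H)) u \<le> 1" .
qed

section \<open>Edges, propagation paths and free variables of a filled context\<close>

lemma edges_fill_mono: "edges H \<subseteq> edges (fill w X \<Gamma> Hs H)"
  by (induction H) (auto simp: image_iff; fastforce)

lemma edges_fill_flat [simp]: "edges (fill w X \<Gamma> {#} H) = edges H"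
  by (induction H) (auto simp: image_iff)

lemma path_mono: "edges H \<subseteq> edges K \<Longrightarrow> path H s w u \<Longrightarrow> path K s w u"
proof (induction s arbitrary: w)
  case (Cons c s)
  then show ?case by (cases c) auto
qed simp

lemma reach_mono: "edges H \<subseteq> edges K \<Longrightarrow> reach H L w u \<Longrightarrow> reach K L w u"
  unfolding reach_def using path_mono by blast

lemma fv_nseq_fill:
  "w \<in># names H \<Longrightarrow> fv_nseq (fill w X \<Gamma> Hs H) =
     fv_nseq H \<union> (\<Union>t\<in>set_mset X. fv_tm t) \<union> (\<Union>\<phi>\<in>set_mset \<Gamma>. fv \<phi>) \<union> (\<Union>K\<in>set_mset Hs. fv_nseq K)"
proof (induction H)
  case (Comp v Y \<Delta> Ks)
  let ?E = "(\<Union>t\<in>set_mset X. fv_tm t) \<union> (\<Union>\<phi>\<in>set_mset \<Gamma>. fv \<phi>) \<union> (\<Union>K\<in>set_mset Hs. fv_nseq K)"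
  show ?case
  proof (cases "v = w")
    case False
    then obtain K where K: "K \<in># Ks" "w \<in># names K" using Comp.prems by auto
    \<comment> \<open>Children without \<open>w\<close> stay unchanged, while those containing it,
      of which \<open>K\<close> is one, receive all of \<open>?E\<close>.\<close>
    have "(\<Union>J\<in>set_mset Ks. fv_nseq (fill w X \<Gamma> Hs J)) =
      (\<Union>J\<in>set_mset Ks. fv_nseq J \<union> (if w \<in># names J then ?E else {}))"
      by (intro SUP_cong refl) (use Comp.IH in \<open>simp add: fill_absent Un_assoc\<close>)
    also have "\<dots> = (\<Union>J\<in>set_mset Ks. fv_nseq J) \<union> ?E"
      using K by (simp only: UN_Un_distrib) (auto split: if_splits)
    finally show ?thesis
      using False by (simp add: multiset.map_comp Un_ac)
  qed (simp add: Un_ac)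
qed

section \<open>Cancellation and decomposition of filled contexts\<close>

primrec unfill :: "name \<Rightarrow> 'c tm multiset \<Rightarrow> ('p, 'c) fm multiset \<Rightarrow> ('p, 'c) nseq \<Rightarrow> ('p, 'c) nseq"
where
  "unfill w X \<Gamma> (Comp v Y \<Delta> Ks) =
     (if v = w then Comp v (Y - X) (\<Delta> - \<Gamma>) Ks else Comp v Y \<Delta> (image_mset (unfill w X \<Gamma>) Ks))"

lemma unfill_fill: "unfill w X \<Gamma> (fill w X \<Gamma> {#} H) = H"
proof (induction H)
  case (Comp v Y \<Delta> Ks)
  have "image_mset (unfill w X \<Gamma> \<circ> fill w X \<Gamma> {#}) Ks = image_mset id Ks"
    using Comp by (intro image_mset_cong) auto
  then show ?case by (simp add: multiset.map_comp)
qed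

lemma fill_inject: "fill w X \<Gamma> {#} H = fill w X \<Gamma> {#} K \<Longrightarrow> H = K"
  by (metis unfill_fill)

text \<open>The hypothesis excludes that the multiset difference, which truncates at the empty
  multiset, takes away a copy of \<open>A\<close> that was supplied by
  \<open>\<Gamma>\<close>.\<close>

lemma unfill_fill_commute:
  assumes "w \<noteq> a \<or> A \<notin># \<Gamma>"
  shows "unfill a {#} {#A#} (fill w X \<Gamma> {#} H) = fill w X \<Gamma> {#} (unfill a {#} {#A#} H)"
proof (induction H)
  case (Comp v Y \<Delta> Ks)
  have "\<Delta> + \<Gamma> - {#A#} = \<Delta> - {#A#} + \<Gamma>" if "A \<notin># \<Gamma>"
    using that by (cases "A \<in># \<Delta>") (auto simp: diff_single_trivial)
  then show ?case
    using assms Comp by (auto simp: multiset.map_comp intro!: image_mset_cong)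
qed

text \<open>One sequent is read in two ways: as a conclusion with the displayed formulas
  \<open>\<Gamma>\<close> in \<open>w\<close>, and as a context holding \<open>A\<close> in
  \<open>a\<close>. If \<open>A\<close> is not one of the displayed formulas, it belongs to the
  context \<open>H\<close>, and taking it out there with \<open>unfill\<close> gives the common
  context \<open>J\<close>.\<close>

lemma fill_eq_fillE:
  assumes "fill w X \<Gamma> {#} H = fill a {#} {#A#} {#} K" "w \<noteq> a \<or> A \<notin># \<Gamma>"
  obtains J where "H = fill a {#} {#A#} {#} J" "K = fill w X \<Gamma> {#} J"
proof
  let ?J = "unfill a {#} {#A#} H"
  show K: "K = fill w X \<Gamma> {#} ?J"
    using unfill_fill_commute[OF assms(2), of X H] assms(1) by (simp add: unfill_fill)
  have "fill w X \<Gamma> {#} H = fill w X \<Gamma> {#} (fill a {#} {#A#} {#} ?J)"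
    using assms(1) K fill_commute_flat[of a "{#}" "{#A#}" w] by simp
  then show "H = fill a {#} {#A#} {#} ?J"
    by (rule fill_inject)
qed

section \<open>Renaming\<close>

fun ren_tm_at :: "(var \<Rightarrow> var) \<Rightarrow> nat \<Rightarrow> 'c tm \<Rightarrow> 'c tm" where
  "ren_tm_at \<pi> d (Var i) = (if i < d then Var i else Var (\<pi> (i - d) + d))"
| "ren_tm_at \<pi> d (Const c) = Const c"

abbreviation ren_tm :: "(var \<Rightarrow> var) \<Rightarrow> 'c tm \<Rightarrow> 'c tm" where
  "ren_tm \<pi> \<equiv> ren_tm_at \<pi> 0"

abbreviation ren_fm :: "(var \<Rightarrow> var) \<Rightarrow> ('p, 'c) fm \<Rightarrow> ('p, 'c) fm" where
  "ren_fm \<pi> \<equiv> map_at (ren_tm_at \<pi>) 0"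

text \<open>Component names and free variables are renamed at the same time: the former to give a
  new child a prescribed name, the latter to move eigenvariables out of the way.\<close>

primrec ren :: "(name \<Rightarrow> name) \<Rightarrow> (var \<Rightarrow> var) \<Rightarrow> ('p, 'c) nseq \<Rightarrow> ('p, 'c) nseq" where
  "ren f \<pi> (Comp w X \<Gamma> Hs) =
     Comp (f w) (image_mset (ren_tm \<pi>) X) (image_mset (ren_fm \<pi>) \<Gamma>) (image_mset (ren f \<pi>) Hs)"

lemma fv_ren_fm_at: "fv_at d (map_at (ren_tm_at \<pi>) d \<phi>) = \<pi> ` fv_at d \<phi>"
proof (induction \<phi> arbitrary: d)
  have tm: "fv_tm_at d (ren_tm_at \<pi> d t) = \<pi> ` fv_tm_at d t" for d and t :: "'b tm"
    by (cases t) auto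
  {
    case Atom then show ?case by (auto simp: tm)
  next
    case NAtom then show ?case by (auto simp: tm)
  next
    case Eq then show ?case by (auto simp: tm)
  next
    case Neq then show ?case by (auto simp: tm)
  }
qed auto

lemma fv_ren_tm: "fv_tm (ren_tm \<pi> t) = \<pi> ` fv_tm t"
  by (cases t) auto

lemma fv_ren: "fv_nseq (ren f \<pi> H) = \<pi> ` fv_nseq H"
  by (induction H) (simp add: fv_ren_fm_at fv_ren_tm image_Un image_UN multiset.map_comp)

lemma ren_tm_at_cong:
  "(\<And>x. x \<in> fv_tm_at d t \<Longrightarrow> \<pi> x = \<rho> x) \<Longrightarrow> ren_tm_at \<pi> d t = ren_tm_at \<rho> d t"
  by (cases t) auto

lemma ren_fm_cong:
  "(\<And>x. x \<in> fv \<phi> \<Longrightarrow> \<pi> x = \<rho> x) \<Longrightarrow> ren_fm \<pi> \<phi> = ren_fm \<rho> \<phi>"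
  by (rule map_at_cong) (blast intro: ren_tm_at_cong)

lemma ren_cong:
  "(\<And>x. x \<in> fv_nseq H \<Longrightarrow> \<pi> x = \<rho> x) \<Longrightarrow> ren f \<pi> H = ren f \<rho> H"
proof (induction H)
  case (Comp w X \<Gamma> Hs)
  have "ren_tm \<pi> t = ren_tm \<rho> t" if "t \<in># X" for t
    using that Comp.prems by (intro ren_tm_at_cong) auto
  moreover have "ren_fm \<pi> \<phi> = ren_fm \<rho> \<phi>" if "\<phi> \<in># \<Gamma>" for \<phi>
    using that Comp.prems by (intro ren_fm_cong) auto
  moreover have "ren f \<pi> H = ren f \<rho> H" if "H \<in># Hs" for H
    using that Comp.prems by (intro Comp.IH) auto
  ultimately show ?case by (auto intro!: image_mset_cong)
qed

lemma ren_ident: "(\<And>w. w \<in># names H \<Longrightarrow> f w = w) \<Longrightarrow> ren f (\<lambda>x. x) H = H"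
proof (induction H)
  case (Comp w X \<Gamma> Hs)
  have "ren_tm_at (\<lambda>x. x) d t = t" for d and t :: "'b tm"
    by (cases t) auto
  then have "ren_tm_at (\<lambda>x. x) = (\<lambda>d t. t :: 'b tm)" by blast
  then have "ren_fm (\<lambda>x. x) = (\<lambda>\<phi>. \<phi> :: ('a, 'b) fm)" "ren_tm (\<lambda>x. x) = (\<lambda>t. t :: 'b tm)"
    by (auto simp: map_at_ident)
  moreover have "image_mset (ren f (\<lambda>x. x)) Hs = image_mset id Hs"
    using Comp by (intro image_mset_cong) auto
  ultimately show ?case using Comp.prems by simp
qed

text \<open>Injectivity guarantees that the free occurrences of \<open>\<pi> x\<close> after
  renaming are precisely the images of those of \<open>x\<close>.\<close>

lemma ren_fm_subst:
  assumes "inj \<pi>"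
  shows "ren_fm \<pi> (subst \<phi> t x) = subst (ren_fm \<pi> \<phi>) (ren_tm \<pi> t) (\<pi> x)"
proof -
  have "ren_tm_at \<pi> e (subst_tm_at t x e u) = subst_tm_at (ren_tm \<pi> t) (\<pi> x) e (ren_tm_at \<pi> e u)"
    for e u
    using assms by (cases u; cases t) (auto simp: inj_eq)
  then show ?thesis unfolding subst_def map_at_map_at by simp
qed

lemma ren_bind:
  fixes \<phi> :: "('p, 'c) fm"
  assumes "inj \<pi>"
  shows "map_at (ren_tm_at \<pi>) (Suc 0) (bind x \<phi>) = bind (\<pi> x) (ren_fm \<pi> \<phi>)"
proof -
  have "ren_tm_at \<pi> (Suc e) (bind_tm_at x e u) = bind_tm_at (\<pi> x) e (ren_tm_at \<pi> e u)"
    for e and u :: "'c tm"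
    using assms by (cases u) (auto simp: inj_eq)
  then show ?thesis unfolding bind_def map_at_Suc map_at_map_at by simp
qed

lemma ren_fm_Forall: "inj \<pi> \<Longrightarrow> ren_fm \<pi> (Forall x \<phi>) = Forall (\<pi> x) (ren_fm \<pi> \<phi>)"
  and ren_fm_Exists: "inj \<pi> \<Longrightarrow> ren_fm \<pi> (Exists x \<phi>) = Exists (\<pi> x) (ren_fm \<pi> \<phi>)"
  by (simp_all add: Forall_def Exists_def ren_bind)

lemma neg_map_at: "neg (map_at h d \<phi>) = map_at h d (neg \<phi>)"
  by (induction \<phi> arbitrary: d) auto

lemma is_literal_map_at [simp]: "is_literal (map_at h d \<phi>) = is_literal \<phi>"
  by (cases \<phi>) auto

lemma is_neg_literal_map_at [simp]: "is_neg_literal (map_at h d \<phi>) = is_neg_literal \<phi>"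
  by (cases \<phi>) auto

section \<open>Renaming of contexts, names and propagation paths\<close>

lemma ren_fill:
  assumes "inj f"
  shows "ren f \<pi> (fill w X \<Gamma> Hs H) = fill (f w) (image_mset (ren_tm \<pi>) X)
    (image_mset (ren_fm \<pi>) \<Gamma>) (image_mset (ren f \<pi>) Hs) (ren f \<pi> H)"
  using assms by (induction H) (auto simp: multiset.map_comp inj_eq intro!: image_mset_cong)

lemma names_ren: "names (ren f \<pi> H) = image_mset f (names H)"
proof (induction H)
  case (Comp w X \<Gamma> Hs)
  then have "\<Sum>\<^sub># (image_mset (names \<circ> ren f \<pi>) Hs) = image_mset f (\<Sum>\<^sub># (image_mset names Hs))"
    by (induction Hs) auto
  then show ?case by (simp add: multiset.map_comp)
qed

lemma uniquely_named_ren: "inj f \<Longrightarrow> uniquely_named H \<Longrightarrow> uniquely_named (ren f \<pi> H)"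
  unfolding uniquely_named_def names_ren
proof
  fix w
  assume f: "inj f" and H: "\<forall>w. count (names H) w \<le> 1"
  have "count (image_mset f M) (f v) = count M v" for v M
    using f by (induction M) (auto simp: inj_eq)
  moreover have "count (image_mset f M) w = 0" if "w \<notin> range f" for M
    using that by (auto simp: count_eq_zero_iff)
  ultimately show "count (image_mset f (names H)) w \<le> 1"
    using H by (cases "w \<in> range f") auto
qed

lemma root_ren [simp]: "root (ren f \<pi> H) = f (root H)"
  by (cases H) simp

lemma edges_ren: "edges (ren f \<pi> H) = map_prod f f ` edges H"
  by (induction H) (simp add: image_Un image_UN image_image multiset.map_comp)

lemma path_ren: "path H s w u \<Longrightarrow> path (ren f \<pi> H) s (f w) (f u)"
proof (induction s arbitrary: w)
  case (Cons c s)
  then show ?case by (cases c) (force simp: edges_ren)+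
qed simp

lemma reach_ren: "reach H L w u \<Longrightarrow> reach (ren f \<pi> H) L (f w) (f u)"
  unfolding reach_def using path_ren by blast

lemma finite_fv_at: "finite (fv_at d \<phi>)"
proof (induction \<phi> arbitrary: d)
  have tm: "finite (fv_tm_at d t)" for d and t :: "'b tm"
    by (cases t) auto
  {
    case Atom then show ?case by (auto simp: tm)
  next
    case NAtom then show ?case by (auto simp: tm)
  next
    case Eq then show ?case by (auto simp: tm)
  next
    case Neq then show ?case by (auto simp: tm)
  }
qed auto

lemma finite_fv_nseq: "finite (fv_nseq H)"
proof (induction H)
  case (Comp w X \<Gamma> Hs)
  have "finite (fv_tm t)" for t :: "'b tm" by (cases t) auto
  then show ?case using Comp by (auto simp: finite_fv_at)
qed

section \<open>Weakening by terms\<close>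

text \<open>Brings the weakened and renamed premise or conclusion of a rule back into the form of a
  filling, so that the same rule applies over the context
  \<open>fill a X {#} {#} (ren f \<pi> H)\<close>. The condition on \<open>Hs\<close> says that the
  added terms do not land in the children displayed by the rule.\<close>

lemma weaken_ren_fill:
  assumes "inj f" "\<And>K. K \<in># Hs \<Longrightarrow> a \<notin># names (ren f \<pi> K)"
  shows "fill a X {#} {#} (ren f \<pi> (fill w Y \<Gamma> Hs H)) =
    fill (f w) (image_mset (ren_tm \<pi>) Y) (image_mset (ren_fm \<pi>) \<Gamma>) (image_mset (ren f \<pi>) Hs)
      (fill a X {#} {#} (ren f \<pi> H))"
  unfolding ren_fill[OF assms(1)] by (rule fill_commute) (use assms(2) in auto)

lemmas weaken_ren_fill_flat = weaken_ren_fill[where Hs = "{#}", simplified]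

lemma weaken_ren_fill_child:
  assumes "inj f" "a \<noteq> f v"
  shows "fill a X {#} {#} (ren f \<pi> (fill w Y \<Gamma> {#Comp v Z \<Delta> {#}#} H)) =
    fill (f w) (image_mset (ren_tm \<pi>) Y) (image_mset (ren_fm \<pi>) \<Gamma>)
      {#Comp (f v) (image_mset (ren_tm \<pi>) Z) (image_mset (ren_fm \<pi>) \<Delta>) {#}#}
      (fill a X {#} {#} (ren f \<pi> H))"
  using assms by (subst weaken_ren_fill) auto

text \<open>The witness is \<open>\<pi>\<close> followed by the transposition of
  \<open>\<pi> y\<close> and \<open>y'\<close>, hence injective. On \<open>V\<close> the map
  \<open>\<pi>\<close> takes neither of these two values, so nothing changes there.\<close>

lemma fresh_renaming:
  fixes \<pi> :: "var \<Rightarrow> var"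
  assumes "inj \<pi>" "y \<notin> V" "y' \<notin> \<pi> ` V"
  obtains \<rho> where "inj \<rho>" "\<rho> y = y'" "\<And>x. x \<in> V \<Longrightarrow> \<rho> x = \<pi> x"
proof
  let ?\<rho> = "\<lambda>z. if z = y then y' else if \<pi> z = y' then \<pi> y else \<pi> z"
  show "inj ?\<rho>" by (rule injI) (auto simp: inj_eq[OF assms(1)] split: if_splits)
  show "\<And>x. x \<in> V \<Longrightarrow> ?\<rho> x = \<pi> x" using assms by auto
qed simp

text \<open>Renaming and weakening are proved together, because the induction hypothesis has to be
  applied to a premise in which the eigenvariable has been renamed away from the added terms.\<close>

lemma weakening_ren:
  assumes "provable C H" "inj f" "inj \<pi>" "a \<in># names (ren f \<pi> H)"
  shows "provable C (fill a X {#} {#} (ren f \<pi> H))"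
  using assms
proof (induction arbitrary: \<pi> rule: provable.induct)
  case (ax H w L)
  then show ?case
    using provable.ax[of "fill a X {#} {#} (ren f \<pi> H)" "f w" "ren_fm \<pi> L" C]
    by (simp add: weaken_ren_fill_flat uniquely_named_fill_flat uniquely_named_ren names_ren neg_map_at)
next
  case (disj w H \<phi> \<psi>)
  then show ?case
    using provable.disj[of "f w" "fill a X {#} {#} (ren f \<pi> H)" C "ren_fm \<pi> \<phi>" "ren_fm \<pi> \<psi>"]
    by (simp add: weaken_ren_fill_flat names_ren names_fill_flat)
next
  case (conj w H \<phi> \<psi>)
  then show ?case
    using provable.conj[of "f w" "fill a X {#} {#} (ren f \<pi> H)" C "ren_fm \<pi> \<phi>" "ren_fm \<pi> \<psi>"]
    by (simp add: weaken_ren_fill_flat names_ren names_fill_flat)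
next
  case (ex w H t x \<psi>)
  then show ?case
    using provable.ex[of "f w" "fill a X {#} {#} (ren f \<pi> H)" C "ren_tm \<pi> t" "\<pi> x" "ren_fm \<pi> \<psi>"]
    by (simp add: weaken_ren_fill_flat names_ren names_fill_flat ren_fm_Exists ren_fm_subst)
next
  case (all w H y x \<phi>)
  let ?K = "fill w {#} {#Forall x \<phi>#} {#} H"
  have fv: "fv_nseq ?K = fv_nseq H \<union> fv (Forall x \<phi>)"
    using all.hyps by (simp add: fv_nseq_fill)
  have "finite (fv_nseq (fill a X {#} {#} (ren f \<pi> ?K)))"
    by (rule finite_fv_nseq)
  \<comment> \<open>The new eigenvariable has to avoid the added terms \<open>X\<close> besides the
    renamed conclusion.\<close>
  then obtain y' where y': "y' \<notin> fv_nseq (fill a X {#} {#} (ren f \<pi> ?K))"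
    using ex_new_if_finite infinite_UNIV_nat by blast
  then have "y' \<notin> \<pi> ` fv_nseq ?K"
    using all.prems by (simp add: fv_nseq_fill fv_ren)
  then obtain \<rho> where \<rho>: "inj \<rho>" "\<rho> y = y'" "\<And>z. z \<in> fv_nseq ?K \<Longrightarrow> \<rho> z = \<pi> z"
    by (rule fresh_renaming[OF all.prems(2) all.hyps(2)]) blast
  \<comment> \<open>Redirecting the eigenvariable is invisible in the conclusion, where it is not
    free. Only the premise is renamed differently, and the induction hypothesis allows any injective
    renaming.\<close>
  have eq: "ren f \<rho> ?K = ren f \<pi> ?K"
    using \<rho>(3) by (rule ren_cong)
  have "provable C (fill a X {#} {#} (ren f \<rho> (fill w {#Var y#} {#subst \<phi> (Var y) x#} {#} H)))"
    by (rule all.IH) (use all.prems \<rho> in \<open>simp_all add: names_ren names_fill_flat\<close>)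
  then have "provable C (fill a X {#} {#} (ren f \<rho> ?K))"
    using provable.all[of "f w" "fill a X {#} {#} (ren f \<rho> H)" y' "\<rho> x" "ren_fm \<rho> \<phi>" C]
      y' all.hyps all.prems \<rho>(1,2)
    unfolding eq[symmetric] by (simp add: weaken_ren_fill_flat names_ren ren_fm_Forall ren_fm_subst)
  then show ?case by (simp only: eq)
next
  case (dia w H u \<phi>)
  have "reach (fill a X {#} {#} (ren f \<pi> H)) (dia_lang C) (f w) (f u)"
    using reach_ren[OF dia.hyps(3), of f \<pi>] by (rule reach_mono[rotated]) simp
  then show ?case
    using dia provable.dia[of "f w" "fill a X {#} {#} (ren f \<pi> H)" "f u" C "ren_fm \<pi> \<phi>"]
    by (simp add: weaken_ren_fill_flat names_ren names_fill_flat)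
next
  case (box w H v \<phi>)
  \<comment> \<open>The target \<open>a\<close> of the weakening is the image of a name of
    \<open>H\<close>, whereas \<open>v\<close> is new to \<open>H\<close>; injectivity of
    \<open>f\<close> keeps \<open>a\<close> apart from the new child.\<close>
  then have "a \<noteq> f v" "f v \<notin># names (ren f \<pi> H)" "f w \<in># names (ren f \<pi> H)"
    "a \<in># names (ren f \<pi> H)"
    by (auto simp: names_ren names_fill_flat inj_eq)
  moreover from this have "a \<in># names (ren f \<pi> (fill w {#} {#} {#Comp v {#} {#\<phi>#} {#}#} H))"
    using box.prems by (simp add: ren_fill names_fillI)
  ultimately show ?case
    using box.prems box.IH[of \<pi>]
      provable.box[of "f w" "fill a X {#} {#} (ren f \<pi> H)" "f v" C "ren_fm \<pi> \<phi>"]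
    by (simp add: weaken_ren_fill_flat weaken_ren_fill_child)
next
  case (ref w H t)
  then show ?case
    using provable.ref[of "f w" "fill a X {#} {#} (ren f \<pi> H)" C "ren_tm \<pi> t"]
    by (simp add: weaken_ren_fill_flat names_ren names_fill_flat)
next
  case (rep w H N t s z)
  then show ?case
    using provable.rep[of "f w" "fill a X {#} {#} (ren f \<pi> H)" "ren_fm \<pi> N" C
        "ren_tm \<pi> t" "ren_tm \<pi> s" "\<pi> z"]
    by (simp add: weaken_ren_fill_flat names_ren names_fill_flat ren_fm_subst)
next
  case (drep w H s t)
  then show ?case
    using provable.drep[of "f w" "fill a X {#} {#} (ren f \<pi> H)" C "ren_tm \<pi> s" "ren_tm \<pi> t"]
    by (simp add: weaken_ren_fill_flat names_ren names_fill_flat)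
next
  case (rig w H u s t)
  then show ?case
    using provable.rig[of "f w" "fill a X {#} {#} (ren f \<pi> H)" "f u" C "ren_tm \<pi> s" "ren_tm \<pi> t"]
    by (simp add: weaken_ren_fill_flat names_ren names_fill_flat inj_eq)
next
  case (dp w H u t)
  have "reach (fill a X {#} {#} (ren f \<pi> H)) (dp_lang C) (f w) (f u)"
    using reach_ren[OF dp.hyps(5), of f \<pi>] by (rule reach_mono[rotated]) simp
  then show ?case
    using dp provable.dp[of C "f w" "fill a X {#} {#} (ren f \<pi> H)" "f u" "ren_tm \<pi> t"]
    by (simp add: weaken_ren_fill_flat names_ren names_fill_flat inj_eq)
next
  case (d w H v)
  then have "a \<noteq> f v" "f v \<notin># names (ren f \<pi> H)" "f w \<in># names (ren f \<pi> H)"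
    by (auto simp: names_ren inj_eq)
  moreover from this have "a \<in># names (ren f \<pi> (fill w {#} {#} {#Comp v {#} {#} {#}#} H))"
    using d.prems by (simp add: ren_fill names_fillI)
  ultimately show ?case
    using d.prems d.hyps d.IH[of \<pi>] provable.d[of C "f w" "fill a X {#} {#} (ren f \<pi> H)" "f v"]
    by (simp add: weaken_ren_fill_flat weaken_ren_fill_child)
next
  case (nd w H y)
  have "finite (fv_nseq (fill a X {#} {#} (ren f \<pi> H)))"
    by (rule finite_fv_nseq)
  then obtain y' where y': "y' \<notin> fv_nseq (fill a X {#} {#} (ren f \<pi> H))"
    using ex_new_if_finite infinite_UNIV_nat by blast
  then have "y' \<notin> \<pi> ` fv_nseq H"
    using nd.prems by (simp add: fv_nseq_fill fv_ren)
  then obtain \<rho> where \<rho>: "inj \<rho>" "\<rho> y = y'" "\<And>z. z \<in> fv_nseq H \<Longrightarrow> \<rho> z = \<pi> z"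
    by (rule fresh_renaming[OF nd.prems(2) nd.hyps(3)]) blast
  have eq: "ren f \<rho> H = ren f \<pi> H"
    using \<rho>(3) by (rule ren_cong)
  have "provable C (fill a X {#} {#} (ren f \<rho> (fill w {#Var y#} {#} {#} H)))"
    by (rule nd.IH) (use nd.prems \<rho> in \<open>simp_all add: names_ren names_fill_flat\<close>)
  then show ?case
    using provable.nd[of C "f w" "fill a X {#} {#} (ren f \<pi> H)" y'] y' nd.hyps nd.prems \<rho>(1,2)
    by (simp add: weaken_ren_fill_flat names_ren eq)
next
  case (cd w H t)
  then show ?case
    using provable.cd[of C "f w" "fill a X {#} {#} (ren f \<pi> H)" "ren_tm \<pi> t"]
    by (simp add: weaken_ren_fill_flat names_ren names_fill_flat)
qed

lemma weakening: "provable C H \<Longrightarrow> a \<in># names H \<Longrightarrow> provable C (fill a X {#} {#} H)"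
  using weakening_ren[of C H "\<lambda>w. w" "\<lambda>x. x" a X] by (simp add: ren_ident)

text \<open>Apply the transposition of \<open>u\<close> and \<open>v\<close>: it fixes
  \<open>H\<close>, in which neither name occurs, and changes only the name of the child.\<close>

lemma rename_new_child:
  assumes "provable C (fill w {#} {#} {#Comp v {#} {#\<phi>#} {#}#} H)"
    "w \<in># names H" "v \<notin># names H" "u \<notin># names H"
  shows "provable C (fill w {#} {#} {#Comp u {#} {#\<phi>#} {#}#} H)"
proof -
  let ?f = "\<lambda>z. if z = v then u else if z = u then v else z"
  have f: "inj ?f" by (auto simp: inj_def)
  have H: "ren ?f (\<lambda>x. x) H = H"
    using assms by (intro ren_ident) auto
  have child: "ren ?f (\<lambda>x. x) (Comp v {#} {#\<phi>#} {#}) = Comp u {#} {#\<phi>#} {#}"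
    using ren_ident[of "Comp v {#} {#\<phi>#} {#}" "\<lambda>x. x"] by simp
  have "w \<noteq> v" "w \<noteq> u" using assms by auto
  then have "ren ?f (\<lambda>x. x) (fill w {#} {#} {#Comp v {#} {#\<phi>#} {#}#} H)
      = fill w {#} {#} {#Comp u {#} {#\<phi>#} {#}#} H"
    by (simp add: ren_fill[OF f] H child del: ren.simps)
  \<comment> \<open>Weakening by the empty multiset of terms is pure renaming.\<close>
  then show ?thesis
    using weakening_ren[OF assms(1) f, of "\<lambda>x. x" w "{#}"] assms(2) by (simp add: names_fillI)
qed

section \<open>Invertibility of the rules for disjunction and box\<close>

text \<open>A disjunction is replaced by two formulas, a box by a new child. Separating what is
  added as formulas from what is added as children lets a single induction on derivations invert
  both rules.\<close>

fun inv_fms :: "('p, 'c) fm \<Rightarrow> ('p, 'c) fm multiset" where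
  "inv_fms (Disj \<phi> \<psi>) = {#\<phi>, \<psi>#}"
| "inv_fms _ = {#}"

fun inv_children :: "name \<Rightarrow> ('p, 'c) fm \<Rightarrow> ('p, 'c) nseq multiset" where
  "inv_children v (Box \<phi>) = {#Comp v {#} {#\<phi>#} {#}#}"
| "inv_children v _ = {#}"

fun invertible :: "('p, 'c) fm \<Rightarrow> bool" where
  "invertible (Disj \<phi> \<psi>) = True"
| "invertible (Box \<phi>) = True"
| "invertible _ = False"

definition inv_fill :: "name \<Rightarrow> ('p, 'c) fm \<Rightarrow> name \<Rightarrow> ('p, 'c) nseq \<Rightarrow> ('p, 'c) nseq" where
  "inv_fill a A v = fill a {#} (inv_fms A) (inv_children v A)"

text \<open>Allows a rule acting in \<open>w\<close> to be reapplied after the inversion, over the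
  inverted context. The condition that \<open>w\<close> differs from \<open>v\<close> keeps the rule
  out of the child that inversion may create.\<close>

lemma inv_fill_fill:
  assumes "\<And>K. K \<in># Hs \<Longrightarrow> a \<notin># names K" "w \<noteq> v"
  shows "inv_fill a A v (fill w X \<Gamma> Hs H) = fill w X \<Gamma> Hs (inv_fill a A v H)"
  unfolding inv_fill_def
  by (rule fill_commute) (use assms in \<open>cases A; auto\<close>)+

lemmas inv_fill_fill_flat = inv_fill_fill[where Hs = "{#}", simplified]

lemma inv_fill_fill_child:
  assumes "a \<noteq> u" "w \<noteq> v"
  shows "inv_fill a A v (fill w X \<Gamma> {#Comp u Y \<Delta> {#}#} H) =
    fill w X \<Gamma> {#Comp u Y \<Delta> {#}#} (inv_fill a A v H)"
  using assms by (intro inv_fill_fill) auto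

lemma names_inv_fill: "u \<noteq> v \<Longrightarrow> u \<in># names (inv_fill a A v H) \<longleftrightarrow> u \<in># names H"
  unfolding inv_fill_def
  using names_fill[of a "{#}" "inv_fms A" "inv_children v A" H] names_fillI
  by (cases A) (auto simp: names_fillI)

lemma uniquely_named_inv_fill:
  "uniquely_named H \<Longrightarrow> v \<notin># names H \<Longrightarrow> uniquely_named (inv_fill a A v H)"
  unfolding inv_fill_def
  by (cases A) (simp_all add: uniquely_named_fill_child uniquely_named_fill_flat)

text \<open>Inversion only exposes parts of \<open>A\<close>, so an eigenvariable that was fresh
  while \<open>A\<close> was present remains fresh.\<close>

lemma fv_inv_fill: "a \<in># names H \<Longrightarrow> fv_nseq (inv_fill a A v H) \<subseteq> fv_nseq H \<union> fv A"
  unfolding inv_fill_def by (cases A) (auto simp: fv_nseq_fill)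

lemma reach_inv_fill: "reach H L w u \<Longrightarrow> reach (inv_fill a A v H) L w u"
  unfolding inv_fill_def by (rule reach_mono[OF edges_fill_mono])

text \<open>The name of the new component only has to avoid the finitely many names used in the
  derivation; this spares renaming the names introduced by the rules above it.\<close>

lemma inversion:
  assumes "provable C H" "H = fill a {#} {#A#} {#} K" "a \<in># names K" "invertible A"
  shows "\<exists>N. finite N \<and> (\<forall>v. v \<notin> N \<longrightarrow> provable C (inv_fill a A v K))"
  using assms(1-3)
proof (induction arbitrary: K rule: provable.induct)
  case (ax H w L)
  \<comment> \<open>The displayed formulas are literals, so the disjunction or box \<open>A\<close>
    must lie in the context.\<close>
  from ax.prems(1) obtain J where J: "H = fill a {#} {#A#} {#} J"
    "K = fill w {#} {#L, neg L#} {#} J"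
    by (rule fill_eq_fillE) (use ax.hyps assms(4) in \<open>cases L; auto\<close>)
  \<comment> \<open>Axioms demand unique names, so the child added by inversion must have a name
    that is new to \<open>J\<close>.\<close>
  have "provable C (inv_fill a A v K)" if "v \<notin># names J" for v
    using that ax.hyps ax.prems provable.ax[of "inv_fill a A v J" w L C]
    by (cases "v = w") (auto simp: J inv_fill_fill_flat inv_fill_fill_child names_inv_fill uniquely_named_inv_fill
        uniquely_named_fill_flat)
  then show ?case by (intro exI[of _ "set_mset (names J)"]) auto
next
  case (disj w H \<phi> \<psi>)
  show ?case
  proof (cases "w = a \<and> A = Disj \<phi> \<psi>")
    case True
    \<comment> \<open>Here \<open>A\<close> is principal; cancelling it shows that the premise
      already is the inverted sequent.\<close>
    then have "H = K" using disj.prems fill_inject by blast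
    then show ?thesis using True disj.hyps by (auto simp: inv_fill_def)
  next
    case False
    \<comment> \<open>Here \<open>A\<close> is not principal, so it lies in the context and occurs
      in the premise as well. The premise is inverted and the rule reapplied; the other rules follow
      the same pattern.\<close>
    from disj.prems(1) obtain J where J: "H = fill a {#} {#A#} {#} J"
      "K = fill w {#} {#Disj \<phi> \<psi>#} {#} J"
      by (rule fill_eq_fillE) (use False in auto)
    have "fill w {#} {#\<phi>, \<psi>#} {#} H = fill a {#} {#A#} {#} (fill w {#} {#\<phi>, \<psi>#} {#} J)"
      unfolding J by (rule fill_commute) auto
    from disj.IH[OF this] obtain N where N: "finite N"
      "\<And>v. v \<notin> N \<Longrightarrow> provable C (inv_fill a A v (fill w {#} {#\<phi>, \<psi>#} {#} J))"
      using disj.prems J by auto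
    have "provable C (inv_fill a A v K)" if "v \<notin> insert w N" for v
      using that N(2)[of v] disj.hyps provable.disj[of w "inv_fill a A v J" C \<phi> \<psi>]
      by (simp add: J inv_fill_fill_flat inv_fill_fill_child names_inv_fill)
    then show ?thesis using N(1) by (intro exI[of _ "insert w N"]) auto
  qed
next
  case (conj w H \<phi> \<psi>)
  from conj.prems(1) obtain J where J: "H = fill a {#} {#A#} {#} J"
    "K = fill w {#} {#Conj \<phi> \<psi>#} {#} J"
    by (rule fill_eq_fillE) (use assms(4) in auto)
  have "fill w {#} {#\<phi>#} {#} H = fill a {#} {#A#} {#} (fill w {#} {#\<phi>#} {#} J)"
    unfolding J by (rule fill_commute) auto
  from conj.IH(1)[OF this] obtain N where N: "finite N"
    "\<And>v. v \<notin> N \<Longrightarrow> provable C (inv_fill a A v (fill w {#} {#\<phi>#} {#} J))"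
    using conj.prems J by auto
  have "fill w {#} {#\<psi>#} {#} H = fill a {#} {#A#} {#} (fill w {#} {#\<psi>#} {#} J)"
    unfolding J by (rule fill_commute) auto
  from conj.IH(2)[OF this] obtain M where M: "finite M"
    "\<And>v. v \<notin> M \<Longrightarrow> provable C (inv_fill a A v (fill w {#} {#\<psi>#} {#} J))"
    using conj.prems J by auto
  have "provable C (inv_fill a A v K)" if "v \<notin> insert w (N \<union> M)" for v
    using that N(2)[of v] M(2)[of v] conj.hyps provable.conj[of w "inv_fill a A v J" C \<phi> \<psi>]
    by (simp add: J inv_fill_fill_flat inv_fill_fill_child names_inv_fill)
  then show ?case using N(1) M(1) by (intro exI[of _ "insert w (N \<union> M)"]) auto
next
  case (ex w H t x \<psi>)
  from ex.prems(1) obtain J where J: "H = fill a {#} {#A#} {#} J"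
    "K = fill w {#t#} {#Exists x \<psi>#} {#} J"
    by (rule fill_eq_fillE) (use assms(4) in \<open>auto simp: Exists_def\<close>)
  have "fill w {#t#} {#Exists x \<psi>, subst \<psi> t x#} {#} H
      = fill a {#} {#A#} {#} (fill w {#t#} {#Exists x \<psi>, subst \<psi> t x#} {#} J)"
    unfolding J by (rule fill_commute) auto
  from ex.IH[OF this] obtain N where N: "finite N" "\<And>v. v \<notin> N \<Longrightarrow>
      provable C (inv_fill a A v (fill w {#t#} {#Exists x \<psi>, subst \<psi> t x#} {#} J))"
    using ex.prems J by auto
  have "provable C (inv_fill a A v K)" if "v \<notin> insert w N" for v
    using that N(2)[of v] ex.hyps provable.ex[of w "inv_fill a A v J" C t x \<psi>]
    by (simp add: J inv_fill_fill_flat inv_fill_fill_child names_inv_fill)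
  then show ?case using N(1) by (intro exI[of _ "insert w N"]) auto
next
  case (all w H y x \<phi>)
  from all.prems(1) obtain J where J: "H = fill a {#} {#A#} {#} J"
    "K = fill w {#} {#Forall x \<phi>#} {#} J"
    by (rule fill_eq_fillE) (use assms(4) in \<open>auto simp: Forall_def\<close>)
  have "fill w {#Var y#} {#subst \<phi> (Var y) x#} {#} H
      = fill a {#} {#A#} {#} (fill w {#Var y#} {#subst \<phi> (Var y) x#} {#} J)"
    unfolding J by (rule fill_commute) auto
  from all.IH[OF this] obtain N where N: "finite N" "\<And>v. v \<notin> N \<Longrightarrow>
      provable C (inv_fill a A v (fill w {#Var y#} {#subst \<phi> (Var y) x#} {#} J))"
    using all.prems J by auto
  have a: "a \<in># names J" using all.prems J by simp
  have "provable C (inv_fill a A v K)" if v: "v \<notin> insert w N" for v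
  proof -
    have "y \<notin> fv_nseq (fill w {#} {#Forall x \<phi>#} {#} (inv_fill a A v J))"
      using v all.hyps a fv_inv_fill[OF a, of A v]
      by (auto simp: J fv_nseq_fill names_inv_fill)
    then show ?thesis
      using v N(2)[of v] all.hyps provable.all[of w "inv_fill a A v J" y x \<phi> C]
      by (simp add: J inv_fill_fill_flat inv_fill_fill_child names_inv_fill)
  qed
  then show ?case using N(1) by (intro exI[of _ "insert w N"]) auto
next
  case (dia w H u \<phi>)
  from dia.prems(1) obtain J where J: "H = fill a {#} {#A#} {#} J"
    "K = fill w {#} {#Dia \<phi>#} {#} J"
    by (rule fill_eq_fillE) (use assms(4) in auto)
  have "fill u {#} {#\<phi>#} {#} (fill w {#} {#Dia \<phi>#} {#} H)
      = fill a {#} {#A#} {#} (fill u {#} {#\<phi>#} {#} (fill w {#} {#Dia \<phi>#} {#} J))"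
    unfolding J by (simp only: fill_commute_flat[of a "{#}" "{#A#}"])
  from dia.IH[OF this] obtain N where N: "finite N" "\<And>v. v \<notin> N \<Longrightarrow>
      provable C (inv_fill a A v (fill u {#} {#\<phi>#} {#} (fill w {#} {#Dia \<phi>#} {#} J)))"
    using dia.prems J by auto
  \<comment> \<open>Taking \<open>A\<close> out changes no edge, and inversion at most adds edges,
    so the propagation condition survives.\<close>
  have "reach J (dia_lang C) w u"
    using dia.hyps(3) unfolding J by (rule reach_mono[rotated]) simp
  then have "provable C (inv_fill a A v K)" if "v \<notin> {w, u} \<union> N" for v
    using that N(2)[of v] dia.hyps(1,2)
      provable.dia[of w "inv_fill a A v J" u C \<phi>]
    by (simp add: J inv_fill_fill_flat inv_fill_fill_child names_inv_fill reach_inv_fill)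
  then show ?case using N(1) by (intro exI[of _ "{w, u} \<union> N"]) auto
next
  case (box w H v' \<phi>)
  show ?case
  proof (cases "w = a \<and> A = Box \<phi>")
    case True
    then have "H = K" using box.prems fill_inject by blast
    \<comment> \<open>The premise has its own name \<open>v'\<close> for the child, which may be
      exchanged for any name absent from \<open>K\<close>.\<close>
    then have "provable C (inv_fill a A v K)" if "v \<notin># names K" for v
      using that True box.hyps rename_new_child[of C w v' \<phi> H v] by (simp add: inv_fill_def)
    then show ?thesis by (intro exI[of _ "set_mset (names K)"]) auto
  next
    case False
    let ?child = "Comp v' {#} {#\<phi>#} {#}"
    from box.prems(1) obtain J where J: "H = fill a {#} {#A#} {#} J"
      "K = fill w {#} {#Box \<phi>#} {#} J"
      by (rule fill_eq_fillE) (use False in auto)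
    have a: "a \<in># names J" "a \<noteq> v'" using box.hyps box.prems J by auto
    have "fill w {#} {#} {#?child#} H = fill a {#} {#A#} {#} (fill w {#} {#} {#?child#} J)"
      unfolding J by (rule fill_commute[symmetric]) (use a in auto)
    from box.IH[OF this names_fillI[OF a(1)]] obtain N where N: "finite N"
      "\<And>v. v \<notin> N \<Longrightarrow> provable C (inv_fill a A v (fill w {#} {#} {#?child#} J))"
      by blast
    \<comment> \<open>Excluding \<open>v'\<close> as well keeps it new to the inverted context, as
      the reapplied box rule requires.\<close>
    have "provable C (inv_fill a A v K)" if "v \<notin> {w, v'} \<union> N" for v
      using that N(2)[of v] a box.hyps provable.box[of w "inv_fill a A v J" v' C \<phi>]
      by (simp add: J inv_fill_fill_flat inv_fill_fill_child names_inv_fill)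
    then show ?thesis using N(1) by (intro exI[of _ "{w, v'} \<union> N"]) auto
  qed
next
  case (ref w H t)
  \<comment> \<open>The conclusion displays nothing, so no decomposition is called for:
    \<open>K\<close> itself is the context left after taking out \<open>A\<close>.\<close>
  have "fill w {#} {#Neq t t#} {#} H = fill a {#} {#A#} {#} (fill w {#} {#Neq t t#} {#} K)"
    unfolding ref.prems(1) by (rule fill_commute) auto
  from ref.IH[OF this] obtain N where N: "finite N"
    "\<And>v. v \<notin> N \<Longrightarrow> provable C (inv_fill a A v (fill w {#} {#Neq t t#} {#} K))"
    using ref.prems by auto
  have "provable C (inv_fill a A v K)" if "v \<notin> insert w N" for v
    using that N(2)[of v] ref.hyps ref.prems provable.ref[of w "inv_fill a A v K" C t]
    by (simp add: inv_fill_fill_flat inv_fill_fill_child names_inv_fill)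
  then show ?case using N(1) by (intro exI[of _ "insert w N"]) auto
next
  case (rep w H L t s z)
  let ?\<Gamma> = "{#Neq t s, subst L t z, subst L s z#}"
  from rep.prems(1) obtain J where J: "H = fill a {#} {#A#} {#} J"
    "K = fill w {#} {#Neq t s, subst L t z#} {#} J"
    by (rule fill_eq_fillE) (use assms(4) rep.hyps in \<open>cases L; auto simp: subst_def\<close>)
  have "fill w {#} ?\<Gamma> {#} H = fill a {#} {#A#} {#} (fill w {#} ?\<Gamma> {#} J)"
    unfolding J by (rule fill_commute) auto
  from rep.IH[OF this] obtain N where N: "finite N"
    "\<And>v. v \<notin> N \<Longrightarrow> provable C (inv_fill a A v (fill w {#} ?\<Gamma> {#} J))"
    using rep.prems J by auto
  have "provable C (inv_fill a A v K)" if "v \<notin> insert w N" for v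
    using that N(2)[of v] rep.hyps provable.rep[of w "inv_fill a A v J" L C t s z]
    by (simp add: J inv_fill_fill_flat inv_fill_fill_child names_inv_fill)
  then show ?case using N(1) by (intro exI[of _ "insert w N"]) auto
next
  case (drep w H s t)
  from drep.prems(1) obtain J where J: "H = fill a {#} {#A#} {#} J"
    "K = fill w {#t#} {#Neq t s#} {#} J"
    by (rule fill_eq_fillE) (use assms(4) in auto)
  have "fill w {#s, t#} {#Neq t s#} {#} H
      = fill a {#} {#A#} {#} (fill w {#s, t#} {#Neq t s#} {#} J)"
    unfolding J by (rule fill_commute) auto
  from drep.IH[OF this] obtain N where N: "finite N"
    "\<And>v. v \<notin> N \<Longrightarrow> provable C (inv_fill a A v (fill w {#s, t#} {#Neq t s#} {#} J))"
    using drep.prems J by auto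
  have "provable C (inv_fill a A v K)" if "v \<notin> insert w N" for v
    using that N(2)[of v] drep.hyps provable.drep[of w "inv_fill a A v J" C s t]
    by (simp add: J inv_fill_fill_flat inv_fill_fill_child names_inv_fill)
  then show ?case using N(1) by (intro exI[of _ "insert w N"]) auto
next
  case (rig w H u s t)
  from rig.prems(1) obtain J where J: "H = fill a {#} {#A#} {#} J"
    "K = fill w {#} {#Neq s t#} {#} J"
    by (rule fill_eq_fillE) (use assms(4) in auto)
  have "fill u {#} {#Neq s t#} {#} (fill w {#} {#Neq s t#} {#} H)
      = fill a {#} {#A#} {#} (fill u {#} {#Neq s t#} {#} (fill w {#} {#Neq s t#} {#} J))"
    unfolding J by (simp only: fill_commute_flat[of a "{#}" "{#A#}"])
  from rig.IH[OF this] obtain N where N: "finite N" "\<And>v. v \<notin> N \<Longrightarrow>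
      provable C (inv_fill a A v (fill u {#} {#Neq s t#} {#} (fill w {#} {#Neq s t#} {#} J)))"
    using rig.prems J by auto
  have "provable C (inv_fill a A v K)" if "v \<notin> {w, u} \<union> N" for v
    using that N(2)[of v] rig.hyps provable.rig[of w "inv_fill a A v J" u C s t]
    by (simp add: J inv_fill_fill_flat inv_fill_fill_child names_inv_fill)
  then show ?case using N(1) by (intro exI[of _ "{w, u} \<union> N"]) auto
next
  case (dp w H u t)
  from dp.prems(1) obtain J where J: "H = fill a {#} {#A#} {#} J"
    "K = fill w {#t#} {#} {#} J"
    by (rule fill_eq_fillE) auto
  have "fill u {#t#} {#} {#} (fill w {#t#} {#} {#} H)
      = fill a {#} {#A#} {#} (fill u {#t#} {#} {#} (fill w {#t#} {#} {#} J))"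
    unfolding J by (simp only: fill_commute_flat[of a "{#}" "{#A#}"])
  from dp.IH[OF this] obtain N where N: "finite N" "\<And>v. v \<notin> N \<Longrightarrow>
      provable C (inv_fill a A v (fill u {#t#} {#} {#} (fill w {#t#} {#} {#} J)))"
    using dp.prems J by auto
  have "reach J (dp_lang C) w u"
    using dp.hyps(5) unfolding J by (rule reach_mono[rotated]) simp
  then have "provable C (inv_fill a A v K)" if "v \<notin> {w, u} \<union> N" for v
    using that N(2)[of v] dp.hyps(1-4) provable.dp[of C w "inv_fill a A v J" u t]
    by (simp add: J inv_fill_fill_flat inv_fill_fill_child names_inv_fill reach_inv_fill)
  then show ?case using N(1) by (intro exI[of _ "{w, u} \<union> N"]) auto
next
  case (d w H v')
  let ?child = "Comp v' {#} {#} {#}"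
  have a: "a \<noteq> v'" using d.hyps d.prems by auto
  have "fill w {#} {#} {#?child#} H = fill a {#} {#A#} {#} (fill w {#} {#} {#?child#} K)"
    unfolding d.prems(1) by (rule fill_commute[symmetric]) (use a in auto)
  from d.IH[OF this names_fillI[OF d.prems(2)]] obtain N where N: "finite N"
    "\<And>v. v \<notin> N \<Longrightarrow> provable C (inv_fill a A v (fill w {#} {#} {#?child#} K))"
    by blast
  have "provable C (inv_fill a A v K)" if "v \<notin> {w, v'} \<union> N" for v
    using that N(2)[of v] a d.hyps d.prems provable.d[of C w "inv_fill a A v K" v']
    by (simp add: inv_fill_fill_flat inv_fill_fill_child names_inv_fill)
  then show ?case using N(1) by (intro exI[of _ "{w, v'} \<union> N"]) auto
next
  case (nd w H y)
  have "fill w {#Var y#} {#} {#} H = fill a {#} {#A#} {#} (fill w {#Var y#} {#} {#} K)"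
    unfolding nd.prems(1) by (rule fill_commute) auto
  from nd.IH[OF this] obtain N where N: "finite N"
    "\<And>v. v \<notin> N \<Longrightarrow> provable C (inv_fill a A v (fill w {#Var y#} {#} {#} K))"
    using nd.prems by auto
  have "y \<notin> fv_nseq (inv_fill a A v K)" for v
    using nd.hyps nd.prems fv_inv_fill[of a K A v] by (auto simp: fv_nseq_fill)
  then have "provable C (inv_fill a A v K)" if "v \<notin> insert w N" for v
    using that N(2)[of v] nd.hyps nd.prems provable.nd[of C w "inv_fill a A v K" y]
    by (simp add: inv_fill_fill_flat inv_fill_fill_child names_inv_fill)
  then show ?case using N(1) by (intro exI[of _ "insert w N"]) auto
next
  case (cd w H t)
  have "fill w {#t#} {#} {#} H = fill a {#} {#A#} {#} (fill w {#t#} {#} {#} K)"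
    unfolding cd.prems(1) by (rule fill_commute) auto
  from cd.IH[OF this] obtain N where N: "finite N"
    "\<And>v. v \<notin> N \<Longrightarrow> provable C (inv_fill a A v (fill w {#t#} {#} {#} K))"
    using cd.prems by auto
  have "provable C (inv_fill a A v K)" if "v \<notin> insert w N" for v
    using that N(2)[of v] cd.hyps cd.prems provable.cd[of C w "inv_fill a A v K" t]
    by (simp add: inv_fill_fill_flat inv_fill_fill_child names_inv_fill)
  then show ?case using N(1) by (intro exI[of _ "insert w N"]) auto
qed

lemma disj_inversion:
  assumes "provable C (fill w {#} {#Disj \<phi> \<psi>#} {#} K)" "w \<in># names K"
  shows "provable C (fill w {#} {#\<phi>, \<psi>#} {#} K)"
proof -
  obtain N where "finite N" "\<And>v. v \<notin> N \<Longrightarrow> provable C (inv_fill w (Disj \<phi> \<psi>) v K)"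
    using inversion[OF assms(1) refl assms(2)] by auto
  \<comment> \<open>For a disjunction no child is added, so the choice of \<open>v\<close> leaves no
    trace in the result.\<close>
  moreover from this(1) obtain v :: name where "v \<notin> N"
    using ex_new_if_finite infinite_UNIV_nat by blast
  ultimately show ?thesis by (auto simp: inv_fill_def)
qed

lemma box_inversion:
  assumes "provable C (fill w {#} {#Box \<phi>#} {#} K)" "w \<in># names K"
  obtains v where "v \<notin># names K" "provable C (fill w {#} {#} {#Comp v {#} {#\<phi>#} {#}#} K)"
proof -
  obtain N where N: "finite N" "\<And>v. v \<notin> N \<Longrightarrow> provable C (inv_fill w (Box \<phi>) v K)"
    using inversion[OF assms(1) refl assms(2)] by auto
  \<comment> \<open>The name is also kept out of \<open>K\<close>, so that the box rule can later be
    applied to the new child.\<close>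
  then have "finite (N \<union> set_mset (names K))" by simp
  then obtain v :: name where "v \<notin> N \<union> set_mset (names K)"
    using ex_new_if_finite infinite_UNIV_nat by blast
  then show thesis using N(2)[of v] that[of v] by (simp add: inv_fill_def)
qed

section \<open>Generalisation below boxes\<close>

text \<open>Shows that \<open>\<phi>\<close> is its own instance for the universal rule when the
  bound variable serves as eigenvariable.\<close>

lemma subst_self: "subst \<phi> (Var x) x = \<phi>"
proof -
  have "subst_tm_at (Var x) x d t = t" for d and t :: "'b tm"
    by (cases t) auto
  then have "subst_tm_at (Var x) x = (\<lambda>d t. t :: 'b tm)" by blast
  then show ?thesis by (simp add: subst_def map_at_ident)
qed

lemma fv_at_neg: "fv_at d (neg \<phi>) = fv_at d \<phi>"
  by (induction \<phi> arbitrary: d) auto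

text \<open>Induction on the list of antecedents with arbitrary component and context. Each step
  inverts a disjunction and a box, leaves the negated antecedent behind in the context, works in the
  new child and then reapplies both rules.\<close>

lemma generalization_below_boxes:
  assumes "provable C (fill w {#} {#foldr (\<lambda>i \<chi>. Imp (\<phi> i) (Box \<chi>)) is \<psi>#} {#} K)"
    and "w \<in># names K" "x \<notin> fv_nseq K" "\<And>i. i \<in> set is \<Longrightarrow> x \<notin> fv (\<phi> i)"
  shows "provable C (fill w {#} {#foldr (\<lambda>i \<chi>. Imp (\<phi> i) (Box \<chi>)) is (Forall x \<psi>)#} {#} K)"
  using assms
proof (induction "is" arbitrary: w K)
  case Nil
  have "provable C (fill w {#Var x#} {#} {#} (fill w {#} {#\<psi>#} {#} K))"
    using Nil.prems by (intro weakening) simp_all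
  then have "provable C (fill w {#Var x#} {#subst \<psi> (Var x) x#} {#} K)"
    by (simp add: fill_fill subst_self)
  \<comment> \<open>Although \<open>x\<close> may be free in \<open>\<psi>\<close>, it is bound in
    the conclusion and absent from the context, so it is a legitimate eigenvariable.\<close>
  moreover have "x \<notin> fv_nseq (fill w {#} {#Forall x \<psi>#} {#} K)"
    using Nil.prems by (simp add: fv_nseq_fill fv_Forall)
  ultimately have "provable C (fill w {#} {#Forall x \<psi>#} {#} K)"
    using Nil.prems(2) by (intro provable.all)
  then show ?case by simp
next
  case (Cons i "is")
  let ?F = "foldr (\<lambda>i \<chi>. Imp (\<phi> i) (Box \<chi>)) is"
  let ?K = "fill w {#} {#neg (\<phi> i)#} {#} K"
  \<comment> \<open>The negated antecedent is absorbed into the context, leaving the boxed formula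
    alone in the hole.\<close>
  have split: "fill w {#} {#neg (\<phi> i), \<chi>#} {#} K = fill w {#} {#\<chi>#} {#} ?K" for \<chi>
    by (simp add: fill_fill add_mset_commute)
  have w: "w \<in># names ?K" using Cons.prems by simp
  have "provable C (fill w {#} {#neg (\<phi> i), Box (?F \<psi>)#} {#} K)"
    using Cons.prems by (intro disj_inversion) (simp_all add: Imp_def)
  then have "provable C (fill w {#} {#Box (?F \<psi>)#} {#} ?K)"
    by (simp only: split)
  then obtain v where v: "v \<notin># names ?K"
    "provable C (fill w {#} {#} {#Comp v {#} {#?F \<psi>#} {#}#} ?K)"
    using w by (rule box_inversion)
  \<comment> \<open>The context for the induction hypothesis: the new child is bare and becomes the
    place of the hole.\<close>
  let ?K' = "fill w {#} {#} {#Comp v {#} {#} {#}#} ?K"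
  have "provable C (fill v {#} {#?F (Forall x \<psi>)#} {#} ?K')"
  proof (rule Cons.IH)
    show "provable C (fill v {#} {#?F \<psi>#} {#} ?K')"
      using v by (simp add: fill_new_child)
    show "v \<in># names ?K'" using w by (rule names_fill_child)
    \<comment> \<open>The only formula added to \<open>K\<close> is the negated antecedent, which
      has the free variables of the antecedent itself.\<close>
    show "x \<notin> fv_nseq ?K'"
      using w Cons.prems by (simp add: fv_nseq_fill fv_at_neg)
  qed (use Cons.prems in simp)
  then have "provable C (fill w {#} {#} {#Comp v {#} {#?F (Forall x \<psi>)#} {#}#} ?K)"
    using v by (simp add: fill_new_child)
  then have "provable C (fill w {#} {#Box (?F (Forall x \<psi>))#} {#} ?K)"
    using w v(1) by (intro provable.box)
  then have "provable C (fill w {#} {#neg (\<phi> i), Box (?F (Forall x \<psi>))#} {#} K)"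
    by (simp only: split)
  then have "provable C (fill w {#} {#Disj (neg (\<phi> i)) (Box (?F (Forall x \<psi>)))#} {#} K)"
    using Cons.prems(2) by (intro provable.disj)
  then show ?case by (simp add: Imp_def)
qed

theorem mainTheorem4:
  fixes C :: "fcond set"
    and n :: nat
    and x :: var
    and \<phi> :: "nat \<Rightarrow> ('p, 'c) fm"
    and r :: name
  assumes "cond_closed C"
    and "\<And>i. i \<le> n \<Longrightarrow> x \<notin> fv (\<phi> i)"
    and "provable C (Comp r {#}
           {# foldr (\<lambda>i \<chi>. Imp (\<phi> i) (Box \<chi>)) [0..<Suc n] (\<phi> (Suc n)) #} {#})"
  shows "provable C (Comp r {#}
           {# foldr (\<lambda>i \<chi>. Imp (\<phi> i) (Box \<chi>)) [0..<Suc n] (Forall x (\<phi> (Suc n))) #} {#})"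
proof -
  let ?K = "Comp r {#} {#} {#} :: ('p, 'c) nseq"
  \<comment> \<open>The single-formula sequent is a filling of the empty one-component context, in
    which no variable is free.\<close>
  have root: "Comp r {#} {#\<chi>#} {#} = fill r {#} {#\<chi>#} {#} ?K" for \<chi>
    by simp
  show ?thesis
    using assms(3) unfolding root
    by (rule generalization_below_boxes) (use assms(2) in auto)
qed

end
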